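(* Let $G$ be a finite group of order $n$ satisfying $$\psi(G)\geq \frac{3}{5}\,n\,\varphi(n).$$ Then $G$ is solvable and $G''\leq Z(G)$.
   Context: For a finite group $G$, $\psi(G)=\sum_{g\in G} o(g)$ denotes the sum of the orders of all elements of $G$. $\varphi$ is Euler's totient function. $G''=[G',G']$ and $Z(G)$ is the center. *)

theory Defs
  imports "HOL-Algebra.Algebra" "HOL-Number_Theory.Number_Theory"
begin

definition psi :: "('a, 'b) monoid_scheme \<Rightarrow> nat" where
  "psi G = (\<Sum>g\<in>carrier G. group.ord G g)"

definition group_center :: "('a, 'b) monoid_scheme \<Rightarrow> 'a set" where
  "group_center G = {z \<in> carrier G. \<forall>g\<in>carrier G. z \<otimes>\<^bsub>G\<^esub> g = g \<otimes>\<^bsub>G\<^esub> z}"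

end

theory Submission
  imports Defs
begin

text \<open>
  An element of maximal order generates a cyclic subgroup \<open>C\<close> whose index \<open>i\<close> is at most
  \<open>5/3 * n / \<phi>(n)\<close>. If \<open>i\<close> is smaller than the largest prime divisor \<open>p\<close> of \<open>n\<close>,
  the Sylow \<open>p\<close>-subgroup \<open>P\<close> of \<open>C\<close> lies in every conjugate of \<open>C\<close> and is therefore normal
  in \<open>G\<close>. One then passes to \<open>G/P\<close>: on the one hand \<open>\<psi>(G) \<le> \<psi>(P) \<psi>(G/P)\<close>, so the
  hypothesis survives up to the factor \<open>1 + 1/(p(p-1))\<close>, and the product of these factors over all
  primes stays small; on the other hand \<open>G' \<le> C\<^sub>G(P)\<close>, and transfer into the central subgroup
  \<open>P\<close> of \<open>C\<^sub>G(P)\<close> shows \<open>G'' \<inter> P = 1\<close>, so centrality of \<open>G''\<close> lifts from \<open>G/P\<close>.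
  What remains are indices \<open>i \<le> 7\<close>. For these, \<open>C \<inter> gCg\<^sup>-\<^sup>1\<close> is centralized by both \<open>C\<close> and
  \<open>gCg\<^sup>-\<^sup>1\<close>, which together usually generate \<open>G\<close>; the quotient by this central subgroup
  has order at most \<open>i(i-1)\<close> and is metabelian.
\<close>

section \<open>Numerical bounds\<close>

text \<open>Passing to \<open>G/P\<close> does not preserve the hypothesis exactly, so the induction
  carries the accumulated loss \<open>excess S\<close> over the set \<open>S\<close> of removed
  primes. Keeping \<open>S\<close> disjoint from the prime divisors of the current order is what
  makes this affordable: a removed prime \<open>q\<close> no longer contributes
  \<open>q/(q-1)\<close> to \<open>n / totient n\<close>, and its correction factor
  \<open>1 + 1/(q(q-1))\<close> is smaller than that. The constant 3/5 enters through its inverse in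
  the bound on \<open>i\<close>. The primes 2, 3, 5, 7 contribute at most 2 * 3/2 * 5/4 * 7/6 = 35/8
  and the primes from 11 on at most 13/12, and 5/3 * 35/8 * 13/12 < 7.9, which leaves
  \<open>i <= 7\<close>. Prime indices admit a uniform argument, so 4 and 6 are the delicate ones.
  For \<open>i = 6\<close> the numerical bound forces 5 or 7 to divide \<open>n\<close>. Removing 7
  is safe, but 5 is smaller than the index and could divide [C : C Int gCg^-1]. That happens only
  when \<open>G\<close> acts two-transitively on the six cosets of \<open>C\<close>, which a count
  in a group of order 30 rules out.\<close>

lemma prime_le_10:
  assumes "Factorial_Ring.prime q" "q \<le> (10::nat)"
  shows "q \<in> {2,3,5,7}"
proof -
  have c: "q \<in> {0,1,2,3,4,5,6,7,8,9,10}"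
    using assms(2) by (simp add: le_Suc_eq numeral_eq_Suc)
  have e: "q = 2 \<or> \<not> 2 dvd q" using assms prime_odd_nat[of q] prime_ge_2_nat[of q] by force
  have "q = 3 \<or> \<not> 3 dvd q" using assms unfolding prime_nat_iff by force
  then show ?thesis using assms(1) c e by (elim insertE) simp_all
qed

text \<open>A new largest element \<open>k+1\<close> multiplies the product by
  \<open>(k+1)/k\<close>, which is exactly the growth of the bound \<open>k/2\<close>. The induction
  starts at 10, where the product is at most 2 * 3/2 * 5/4 * 7/6 = 35/8 <= 5.\<close>

lemma prod_prime_ratio_le:
  fixes A :: "nat set"
  assumes "k \<ge> 10" "\<forall>q\<in>A. Factorial_Ring.prime q \<and> q \<le> k"
  shows "(\<Prod>q\<in>A. real q / (real q - 1)) \<le> real k / 2"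
  using assms
proof (induction k arbitrary: A rule: dec_induct)
  case base
  have "A \<subseteq> {2,3,5,7}"
  proof
    fix q assume "q \<in> A"
    then have q: "Factorial_Ring.prime q" "q \<le> 10" using base by auto
    then show "q \<in> {2,3,5,7}" by (rule prime_le_10)
  qed
  then have "(\<Prod>q\<in>A. real q / (real q - 1)) \<le> (\<Prod>q\<in>{2,3,5,7::nat}. real q / (real q - 1))"
    by (intro prod_mono2) auto
  also have "\<dots> \<le> real 10 / 2" by simp
  finally show ?case .
next
  case (step k)
  have fin: "finite A" using step.prems finite_subset[of A "{..Suc k}"] by auto
  have IH: "(\<Prod>q\<in>A - {Suc k}. real q / (real q - 1)) \<le> real k / 2"
    using step.prems by (intro step.IH) (auto simp: le_Suc_eq)
  show ?case
  proof (cases "Suc k \<in> A")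
    case True
    have "(\<Prod>q\<in>A. real q / (real q - 1)) = real (Suc k) / (real (Suc k) - 1) * (\<Prod>q\<in>A - {Suc k}. real q / (real q - 1))"
      using True fin by (simp add: prod.remove)
    also have "\<dots> \<le> real (Suc k) / (real (Suc k) - 1) * (real k / 2)"
      using step by (intro mult_left_mono IH) auto
    also have "\<dots> = real (Suc k) / 2" using step by (simp add: field_simps)
    finally show ?thesis .
  next
    case False
    then have "A - {Suc k} = A" by auto
    then show ?thesis using IH by simp
  qed
qed

abbreviation excess :: "nat set \<Rightarrow> real" where
  "excess S \<equiv> \<Prod>q\<in>S. 1 + 1 / (real q * (real q - 1))"

text \<open>Makes \<open>\<Prod>\<^sub>m (1 + 1/((2m+1)2m))\<close> telescope against \<open>4m/(4m+1)\<close>.\<close>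
lemma telescope_ineq:
  assumes "x \<ge> (0::real)"
  shows "(4 * x / (4 * x + 1)) * (1 + 1 / ((2*x+3) * (2*x+2))) \<le> 4 * (x+1) / (4 * (x+1) + 1)"
proof -
  define D where "D = (2*x+3) * (2*x+2)"
  have D: "D > 0" using assms by (simp add: D_def)
  have "4 * x * (D + 1) * (4*(x+1)+1) \<le> 4 * (x+1) * ((4 * x + 1) * D)"
    using assms by (simp add: D_def algebra_simps)
  then have "4 * x * (D + 1) / ((4 * x + 1) * D) \<le> 4 * (x+1) / (4 * (x+1) + 1)"
    using D assms by (simp add: pos_divide_le_eq pos_le_divide_eq)
  moreover have "1 + 1 / D = (D + 1) / D" using D by (simp add: field_simps)
  ultimately show ?thesis by (simp add: D_def)
qed

text \<open>The primes are enlarged to all odd numbers \<open>2m+1\<close> with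
  \<open>m >= 4\<close>, whose product is bounded by \<open>c * 4M/(4M+1)\<close>. The start
  \<open>M = 4\<close> requires \<open>c * 16/17 >= 73/72\<close>, that is
  \<open>c >= 1.0773...\<close>; 13/12 is a convenient fraction above this.\<close>

lemma excess_tail:
  assumes "finite S" "\<forall>q\<in>S. Factorial_Ring.prime q \<and> q \<ge> 8"
  shows "excess S \<le> 13/12"
proof -
  define M where "M = Max (insert 4 S)"
  have M: "M \<ge> 4" "\<forall>q\<in>S. q \<le> M" using assms by (auto simp: M_def)
  have "S \<subseteq> (\<lambda>m. 2*m+1) ` {4..M}"
  proof
    fix q assume q: "q \<in> S"
    then have "odd q" using assms prime_odd_nat[of q] by auto
    then obtain m where "q = 2*m+1" by (auto elim: oddE)
    moreover have "q \<ge> 8" "q \<le> M" using q assms M by auto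
    ultimately show "q \<in> (\<lambda>m. 2*m+1) ` {4..M}" by (intro image_eqI[of _ _ m]) auto
  qed
  then have "excess S \<le> excess ((\<lambda>m. 2*m+1) ` {4..M})"
    by (intro prod_mono2) (auto intro!: add_nonneg_nonneg)
  also have "\<dots> = (\<Prod>m\<in>{4..M}. 1 + 1 / (real (2*m+1) * (real (2*m+1) - 1)))"
    by (subst prod.reindex) (auto simp: inj_on_def)
  also have "\<dots> \<le> 13/12 * (4 * real M / (4 * real M + 1))"
    using M(1)
  proof (induction M rule: dec_induct)
    case base show ?case by simp
  next
    case (step n)
    have "(\<Prod>m\<in>{4..Suc n}. 1 + 1 / (real (2*m+1) * (real (2*m+1) - 1)))
      = (\<Prod>m\<in>{4..n}. 1 + 1 / (real (2*m+1) * (real (2*m+1) - 1))) * (1 + 1 / (real (2*Suc n+1) * (real (2*Suc n+1) - 1)))"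
      using step by (simp add: prod.atLeastAtMost_shift_bounds del: of_nat_mult of_nat_Suc)
    also have "\<dots> \<le> 13/12 * (4 * real n / (4 * real n + 1)) * (1 + 1 / (real (2*Suc n+1) * (real (2*Suc n+1) - 1)))"
      by (intro mult_right_mono step.IH) auto
    also have "\<dots> \<le> 13/12 * (4 * real (Suc n) / (4 * real (Suc n) + 1))"
    proof -
      have x: "real n \<ge> 0" by simp
      have "real (2*Suc n+1) = 2 * real n + 3" "real (2*Suc n+1) - 1 = 2 * real n + 2" "real (Suc n) = real n + 1" by auto
      then show ?thesis using mult_left_mono[OF telescope_ineq[OF x], of "13/12"]
        by (simp only: mult.assoc)
    qed
    finally show ?case .
  qed
  also have "\<dots> \<le> 13/12 * 1" using M by (intro mult_left_mono) auto
  finally show ?thesis by simp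
qed

lemma excess_le:
  assumes "finite S" "\<forall>q\<in>S. Factorial_Ring.prime q \<and> q \<ge> 5"
  shows "excess S \<le> excess (S \<inter> {5,7}) * (13/12)"
proof -
  have "q \<ge> 8" if "q \<in> S" "q \<noteq> 5" "q \<noteq> 7" for q
  proof -
    have q: "Factorial_Ring.prime q" "q \<ge> 5" using assms that by auto
    then have "odd q" using prime_odd_nat[of q] by simp
    then have "q \<noteq> 6" by auto
    then show ?thesis using q(2) that by linarith
  qed
  then have e1: "excess (S - {5,7}) \<le> 13/12" using assms by (intro excess_tail) auto
  have e2: "excess (S \<inter> {5,7}) \<ge> 0" by (intro prod_nonneg) auto
  have e3: "excess S = excess (S \<inter> {5,7}) * excess (S - {5,7})"
    by (rule prod.Int_Diff[OF assms(1)])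
  show ?thesis by (subst e3) (rule mult_left_mono[OF e1 e2])
qed

lemma nat_div_totient:
  assumes "n > 0"
  shows "real n / real (totient n) = (\<Prod>q\<in>prime_factors n. real q / (real q - 1))"
proof -
  have "real (totient n) = real n * (\<Prod>q\<in>prime_factors n. 1 - 1 / real q)" by (rule totient_formula2)
  also have "(\<Prod>q\<in>prime_factors n. 1 - 1 / real q) = (\<Prod>q\<in>prime_factors n. inverse (real q / (real q - 1)))"
    by (intro prod.cong refl) (auto simp: field_simps dest!: in_prime_factors_imp_prime prime_gt_0_nat)
  also have "\<dots> = inverse (\<Prod>q\<in>prime_factors n. real q / (real q - 1))" by (rule prod_inversef[unfolded o_def])
  finally show ?thesis using assms by (simp add: field_simps)
qed

text \<open>The margin is small: with \<open>n / totient n <= p/2\<close> the factor in front of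
  \<open>p\<close> is 5/3 * 1/2 * (21/20 * 43/42) * 13/12 = 559/576.\<close>

lemma index_bound_large:
  assumes "n > 0" "finite S" "\<forall>q\<in>S. Factorial_Ring.prime q \<and> q \<ge> 5"
    and "p \<ge> 11" "\<forall>q\<in>prime_factors n. q \<le> p"
  shows "5/3 * (real n / real (totient n) * excess S) < real p"
proof -
  have "excess (S \<inter> {5,7}) \<le> excess {5,7::nat}"
    by (intro prod_mono2) auto
  then have e: "excess S \<le> 21/20 * (43/42) * (13/12)" using excess_le[OF assms(2,3)] by simp
  have r: "real n / real (totient n) \<le> real p / 2"
    unfolding nat_div_totient[OF assms(1)] using assms(4,5) by (intro prod_prime_ratio_le) (auto dest: in_prime_factors_imp_prime)
  have "(real n / real (totient n)) * excess S \<le> real p / 2 * (21/20 * (43/42) * (13/12))"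
    by (intro mult_mono r e) (auto intro!: prod_nonneg add_nonneg_nonneg mult_nonneg_nonneg simp: of_nat_diff dest!: bspec[OF assms(3)])
  moreover have "5/3 * u < real p" if "u \<le> real p / 2 * (21/20 * (43/42) * (13/12))" for u
    using that assms(4) by simp
  ultimately show ?thesis by blast
qed

lemma index_bound_small:
  assumes "n > 0" "finite S" "\<forall>q\<in>S. Factorial_Ring.prime q \<and> q \<ge> 5" "S \<inter> prime_factors n = {}"
    and "\<forall>q\<in>prime_factors n. q < 11"
  shows "5/3 * (real n / real (totient n) * excess S) < 8"
    and "5 \<notin> prime_factors n \<Longrightarrow> 7 \<notin> prime_factors n \<Longrightarrow> 5/3 * (real n / real (totient n) * excess S) < 6"
proof -
  let ?A = "prime_factors n" and ?B = "S \<inter> {5,7}"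
  let ?r = "\<lambda>q. real q / (real q - 1)"
  have A: "?A \<subseteq> {2,3,5,7}"
  proof
    fix q assume "q \<in> ?A"
    then have q: "Factorial_Ring.prime q" "q \<le> 10" using assms(5) by (auto dest: in_prime_factors_imp_prime)
    then show "q \<in> {2,3,5,7}" by (rule prime_le_10)
  qed
  have key: "real n / real (totient n) * excess S \<le> (\<Prod>q\<in>?A. ?r q) * excess ?B * (13/12)"
    unfolding nat_div_totient[OF assms(1), symmetric] mult.assoc
    by (intro mult_left_mono excess_le[OF assms(2,3)]) auto
  \<comment> \<open>The summand 1/10 makes the inequality strict; the values 7.899... and 5.822...
    obtained below stay under 8 and 6 after adding it.\<close>
  have concl: "5/3 * u < 5/3 * 13/12 * c + 1/10" if "u \<le> v * (13/12)" "v \<le> c" for u v c :: real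
    using that by simp
  \<comment> \<open>Since \<open>1 + 1/(q(q-1)) <= q/(q-1)\<close>, each correction factor may be
    replaced by the ratio of a prime that no longer divides \<open>n\<close>. By disjointness every
    prime of {2,3,5,7} is then counted at most once.\<close>
  have "(\<Prod>q\<in>?A. ?r q) * excess ?B \<le> (\<Prod>q\<in>?A. ?r q) * (\<Prod>q\<in>?B. ?r q)"
    using A by (intro mult_left_mono prod_mono prod_nonneg) (auto simp: field_simps)
  also have "\<dots> = (\<Prod>q\<in>?A \<union> ?B. ?r q)"
    using assms(4) by (subst prod.union_disjoint) auto
  also have "\<dots> \<le> (\<Prod>q\<in>{2,3,5,7}. ?r q)"
    using A by (intro prod_mono2) auto
  finally show "5/3 * (real n / real (totient n) * excess S) < 8" using concl[OF key] by fastforce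
  assume "5 \<notin> ?A" "7 \<notin> ?A"
  with A have A': "?A \<subseteq> {2,3}" by auto
  \<comment> \<open>Although 5 and 7 do not divide \<open>n\<close>, they may lie in
    \<open>S\<close>, so both correction factors are kept: 5/3 * 3 * 43/40 * 13/12 < 5.9.\<close>
  have "(\<Prod>q\<in>?A. ?r q) * excess ?B \<le> (\<Prod>q\<in>{2,3}. ?r q) * excess {5,7}"
    using A' by (intro mult_mono prod_mono2 prod_nonneg) auto
  then show "5/3 * (real n / real (totient n) * excess S) < 6" using concl[OF key] by fastforce
qed

section \<open>Conjugation, double cosets and quotients\<close>

lemma card_eq_mult_card_image:
  assumes "finite A" "\<And>x. x \<in> A \<Longrightarrow> card {y \<in> A. f y = f x} = k"
  shows "card A = k * card (f ` A)"
proof -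
  have "card A = (\<Sum>z\<in>f ` A. card {y \<in> A. f y = z})"
    using sum.image_gen[OF assms(1), of "\<lambda>_. 1::nat" f] by simp
  also have "\<dots> = (\<Sum>z\<in>f ` A. k)" using assms(2) by (intro sum.cong refl) auto
  finally show ?thesis by (simp add: mult.commute)
qed

context group
begin

text \<open>This is the intersection of \<open>C\<close> with its conjugate gCg^-1: an element
  \<open>c\<close> lies in gCg^-1 iff \<open>inv g \<otimes> c \<otimes> g\<close> lies in
  \<open>C\<close>.\<close>

definition inter_conj :: "'a set \<Rightarrow> 'a \<Rightarrow> 'a set" where
  "inter_conj C g = {c \<in> C. inv g \<otimes> c \<otimes> g \<in> C}"

definition double_coset :: "'a set \<Rightarrow> 'a \<Rightarrow> 'a set" where
  "double_coset C g = (\<lambda>(a, b). a \<otimes> g \<otimes> b) ` (C \<times> C)"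

lemma conj_mult:
  assumes "g \<in> carrier G" "x \<in> carrier G" "y \<in> carrier G"
  shows "g \<otimes> (x \<otimes> y) \<otimes> inv g = (g \<otimes> x \<otimes> inv g) \<otimes> (g \<otimes> y \<otimes> inv g)"
    and "inv g \<otimes> (x \<otimes> y) \<otimes> g = (inv g \<otimes> x \<otimes> g) \<otimes> (inv g \<otimes> y \<otimes> g)"
proof -
  have *: "h \<otimes> (x \<otimes> y) \<otimes> inv h = (h \<otimes> x \<otimes> inv h) \<otimes> (h \<otimes> y \<otimes> inv h)" if h: "h \<in> carrier G" for h
  proof -
    have "(h \<otimes> x \<otimes> inv h) \<otimes> (h \<otimes> y \<otimes> inv h) = h \<otimes> x \<otimes> (inv h \<otimes> h) \<otimes> y \<otimes> inv h"
      using assms h by (simp only: m_assoc inv_closed m_closed)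
    then show ?thesis using assms h by (simp add: m_assoc)
  qed
  from *[OF assms(1)] *[of "inv g"] assms
  show "g \<otimes> (x \<otimes> y) \<otimes> inv g = (g \<otimes> x \<otimes> inv g) \<otimes> (g \<otimes> y \<otimes> inv g)"
    and "inv g \<otimes> (x \<otimes> y) \<otimes> g = (inv g \<otimes> x \<otimes> g) \<otimes> (inv g \<otimes> y \<otimes> g)" by auto
qed

lemma conj_pow:
  assumes "g \<in> carrier G" "x \<in> carrier G"
  shows "(g \<otimes> x \<otimes> inv g) [^] (k::nat) = g \<otimes> x [^] k \<otimes> inv g"
  using assms by (induction k) (auto simp: conj_mult)

lemma conj_cancel:
  assumes "g \<in> carrier G" "x \<in> carrier G"
  shows "inv g \<otimes> (g \<otimes> x \<otimes> inv g) \<otimes> g = x" "g \<otimes> (inv g \<otimes> x \<otimes> g) \<otimes> inv g = x"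
proof -
  have "inv g \<otimes> (g \<otimes> x \<otimes> inv g) \<otimes> g = (inv g \<otimes> g) \<otimes> x \<otimes> (inv g \<otimes> g)"
    using assms by (simp only: m_assoc inv_closed m_closed)
  then show "inv g \<otimes> (g \<otimes> x \<otimes> inv g) \<otimes> g = x" using assms by simp
  have "g \<otimes> (inv g \<otimes> x \<otimes> g) \<otimes> inv g = (g \<otimes> inv g) \<otimes> x \<otimes> (g \<otimes> inv g)"
    using assms by (simp only: m_assoc inv_closed m_closed)
  then show "g \<otimes> (inv g \<otimes> x \<otimes> g) \<otimes> inv g = x" using assms by simp
qed

lemma inter_conj_subgroup:
  assumes "subgroup C G" "g \<in> carrier G"
  shows "subgroup (inter_conj C g) G"
proof (rule subgroupI)
  interpret C: subgroup C G by fact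
  show "inter_conj C g \<subseteq> carrier G" using C.subset by (auto simp: inter_conj_def)
  have "\<one> \<in> inter_conj C g" using assms by (auto simp: inter_conj_def)
  then show "inter_conj C g \<noteq> {}" by auto
  fix a assume a: "a \<in> inter_conj C g"
  then have ac: "a \<in> carrier G" "a \<in> C" "inv g \<otimes> a \<otimes> g \<in> C" using C.subset by (auto simp: inter_conj_def)
  have "inv g \<otimes> inv a \<otimes> g = inv (inv g \<otimes> a \<otimes> g)"
    using ac assms by (simp add: inv_mult_group m_assoc)
  then show "inv a \<in> inter_conj C g" using ac by (auto simp: inter_conj_def)
  fix b assume b: "b \<in> inter_conj C g"
  then have "b \<in> carrier G" "b \<in> C" "inv g \<otimes> b \<otimes> g \<in> C" using C.subset by (auto simp: inter_conj_def)
  then show "a \<otimes> b \<in> inter_conj C g" using ac assms conj_mult(2)[of g a b] by (auto simp: inter_conj_def)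
qed

lemma inter_conj_subset: "inter_conj C g \<subseteq> C"
  by (auto simp: inter_conj_def)

lemma card_subgroup_dvd:
  assumes "subgroup K G" "subgroup C G" "K \<subseteq> C"
  shows "card K dvd card C"
proof -
  have "card (rcosets\<^bsub>G\<lparr>carrier := C\<rparr>\<^esub> K) * card K = order (G\<lparr>carrier := C\<rparr>)"
    by (rule group.lagrange[OF subgroup_imp_group[OF assms(2)] subgroup_incl[OF assms]])
  moreover have "order (G\<lparr>carrier := C\<rparr>) = card C" by (simp add: order_def)
  ultimately show ?thesis by (metis dvd_triv_right)
qed

lemma card_subgroup_dvd_order:
  assumes "subgroup K G" shows "card K dvd order G"
  using lagrange[OF assms] by (metis dvd_triv_right)

text \<open>The map \<open>(a, b) -> a g b\<close> on \<open>C \<times> C\<close> has fibres of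
  constant size: the pairs over \<open>a0 g b0\<close> are \<open>(a0 m, inv g (inv m) g b0)\<close>
  with \<open>m\<close> in the intersection.\<close>

lemma card_double_coset:
  assumes "finite (carrier G)" "subgroup C G" "g \<in> carrier G"
  shows "card C * card C = card (inter_conj C g) * card (double_coset C g)"
proof -
  interpret C: subgroup C G by fact
  have fin: "finite C" using assms finite_subset[OF C.subset] by auto
  have "card (C \<times> C) = card (inter_conj C g) * card ((\<lambda>(a, b). a \<otimes> g \<otimes> b) ` (C \<times> C))"
  proof (rule card_eq_mult_card_image)
    show "finite (C \<times> C)" using fin by auto
    fix x assume "x \<in> C \<times> C"
    then obtain a0 b0 where x: "x = (a0,b0)" "a0 \<in> C" "b0 \<in> C" by auto
    have xc: "a0 \<in> carrier G" "b0 \<in> carrier G" using x C.subset by auto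
    let ?F = "{y \<in> C \<times> C. (case y of (a,b) \<Rightarrow> a \<otimes> g \<otimes> b) = (case x of (a,b) \<Rightarrow> a \<otimes> g \<otimes> b)}"
    let ?h = "\<lambda>m. (a0 \<otimes> m, (inv g \<otimes> inv m \<otimes> g) \<otimes> b0)"
    have "bij_betw ?h (inter_conj C g) ?F"
    proof (rule bij_betwI[where g = "\<lambda>(a,b). inv a0 \<otimes> a"])
      show "?h \<in> inter_conj C g \<rightarrow> ?F"
      proof
        fix m assume m: "m \<in> inter_conj C g"
        then have mc: "m \<in> carrier G" "m \<in> C" "inv g \<otimes> m \<otimes> g \<in> C" using C.subset by (auto simp: inter_conj_def)
        have "inv g \<otimes> inv m \<otimes> g \<in> C"
          using subgroup.m_inv_closed[OF inter_conj_subgroup[OF assms(2,3)] m] by (simp add: inter_conj_def)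
        moreover have "a0 \<otimes> m \<otimes> g \<otimes> ((inv g \<otimes> inv m \<otimes> g) \<otimes> b0) = a0 \<otimes> (m \<otimes> (g \<otimes> inv g) \<otimes> inv m) \<otimes> g \<otimes> b0"
          using mc xc assms by (simp only: m_assoc inv_closed m_closed)
        ultimately show "?h m \<in> ?F" using mc x xc assms by auto
      qed
      show "(\<lambda>(a,b). inv a0 \<otimes> a) \<in> ?F \<rightarrow> inter_conj C g"
      proof clarsimp
        fix a b assume ab: "a \<in> C" "b \<in> C" and e: "a \<otimes> g \<otimes> b = (case x of (a,b) \<Rightarrow> a \<otimes> g \<otimes> b)"
        have abc: "a \<in> carrier G" "b \<in> carrier G" using ab C.subset by auto
        have e': "a \<otimes> g = a0 \<otimes> g \<otimes> b0 \<otimes> inv b" using e abc xc x assms by (simp add: inv_solve_right)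
        have "inv g \<otimes> (inv a0 \<otimes> a) \<otimes> g = inv g \<otimes> inv a0 \<otimes> (a \<otimes> g)" using abc xc assms by (simp add: m_assoc)
        also have "\<dots> = inv g \<otimes> (inv a0 \<otimes> a0) \<otimes> g \<otimes> (b0 \<otimes> inv b)" unfolding e' using abc xc assms by (simp only: m_assoc inv_closed m_closed)
        also have "\<dots> = b0 \<otimes> inv b" using abc xc assms by simp
        finally show "inv a0 \<otimes> a \<in> inter_conj C g" using ab x by (auto simp: inter_conj_def)
      qed
      show "(case ?h m of (a,b) \<Rightarrow> inv a0 \<otimes> a) = m" if "m \<in> inter_conj C g" for m
        using that xc C.subset by (auto simp: inter_conj_def m_assoc[symmetric])
      show "?h (case y of (a,b) \<Rightarrow> inv a0 \<otimes> a) = y" if "y \<in> ?F" for y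
      proof -
        obtain a b where y: "y = (a,b)" by force
        have ab: "a \<in> C" "b \<in> C" and e: "a \<otimes> g \<otimes> b = a0 \<otimes> g \<otimes> b0" using that y x by auto
        have abc: "a \<in> carrier G" "b \<in> carrier G" using ab C.subset by auto
        have "inv g \<otimes> inv (inv a0 \<otimes> a) \<otimes> g \<otimes> b0 = inv g \<otimes> inv a \<otimes> (a0 \<otimes> g \<otimes> b0)"
          using abc xc assms by (simp add: m_assoc inv_mult_group)
        also have "\<dots> = inv g \<otimes> (inv a \<otimes> a) \<otimes> g \<otimes> b" unfolding e[symmetric] using abc assms by (simp only: m_assoc inv_closed m_closed)
        also have "\<dots> = b" using abc assms by simp
        finally show ?thesis using y abc xc by (simp add: m_assoc[symmetric])
      qed
    qed
    then show "card ?F = card (inter_conj C g)" by (simp add: bij_betw_same_card)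
  qed
  then show ?thesis by (simp add: card_cartesian_product double_coset_def)
qed

text \<open>Here \<open>t\<close> is the index of the intersection in \<open>C\<close>, and equally
  the number of cosets of \<open>C\<close> inside the double coset CgC. As \<open>g\<close> is
  outside \<open>C\<close>, CgC misses \<open>C\<close>, so \<open>t + 1\<close> is at most the
  index of \<open>C\<close>. Equality means that there are only two double cosets, so
  \<open>G\<close> acts two-transitively on the cosets of \<open>C\<close>.\<close>

lemma index_inter_conj:
  assumes "finite (carrier G)" "subgroup C G" "g \<in> carrier G" "g \<notin> C"
  obtains t where "card C = t * card (inter_conj C g)" "t > 0" "t * card C + card C \<le> order G"
    "card (double_coset C g) = t * card C"
    "t * card C + card C = order G \<Longrightarrow> carrier G - C \<subseteq> double_coset C g"
proof -
  interpret C: subgroup C G by fact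
  have fin: "finite C" using assms finite_subset[OF C.subset] by auto
  have C0: "card C > 0" using fin C.one_closed by (metis card_gt_0_iff empty_iff)
  from card_subgroup_dvd[OF inter_conj_subgroup[OF assms(2,3)] assms(2) inter_conj_subset]
  obtain t where t: "card C = t * card (inter_conj C g)" by (metis dvdE mult.commute)
  have "0 < t * card (inter_conj C g)" using C0 by (simp only: t[symmetric])
  then have t0: "t > 0" "card (inter_conj C g) > 0" by simp_all
  have "card (inter_conj C g) * (t * card C) = card (inter_conj C g) * card (double_coset C g)"
    using card_double_coset[OF assms(1-3)] t by (simp add: algebra_simps)
  then have d: "card (double_coset C g) = t * card C" using t0 by simp
  have sub: "double_coset C g \<subseteq> carrier G - C"
  proof
    fix z assume "z \<in> double_coset C g"
    then obtain a b where z: "z = a \<otimes> g \<otimes> b" "a \<in> C" "b \<in> C" by (auto simp: double_coset_def)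
    have c: "a \<in> carrier G" "b \<in> carrier G" using z C.subset by auto
    have "z \<notin> C"
    proof
      assume "z \<in> C"
      then have "inv a \<otimes> z \<otimes> inv b \<in> C" using z by auto
      moreover have "inv a \<otimes> z \<otimes> inv b = (inv a \<otimes> a) \<otimes> g \<otimes> (b \<otimes> inv b)"
        unfolding z(1) using c assms by (simp only: m_assoc inv_closed m_closed)
      ultimately show False using c assms by simp
    qed
    then show "z \<in> carrier G - C" using z c assms by auto
  qed
  have cd: "card (carrier G - C) = order G - card C" "card C \<le> order G"
    using assms C.subset fin by (auto simp: card_Diff_subset order_def intro: card_mono)
  show thesis
  proof (rule that[OF t t0(1)])
    show "t * card C + card C \<le> order G" using card_mono[OF _ sub] assms d cd by simp
    show "card (double_coset C g) = t * card C" by (rule d)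
    show "t * card C + card C = order G \<Longrightarrow> carrier G - C \<subseteq> double_coset C g"
      using card_subset_eq[OF _ sub] assms d cd by simp
  qed
qed

lemma mem_generate_singleton:
  assumes "finite (carrier G)" "x \<in> carrier G"
  shows "y \<in> generate G {x} \<longleftrightarrow> (\<exists>k::nat. y = x [^] k)"
  using generate_pow_nat[OF assms(2)] ord_ge_1[OF assms] by auto

lemma generate_singleton_subgroup: "x \<in> carrier G \<Longrightarrow> subgroup (generate G {x}) G"
  by (rule generate_is_subgroup) auto

lemma generate_singleton_comm:
  assumes "finite (carrier G)" "x \<in> carrier G" "a \<in> generate G {x}" "b \<in> generate G {x}"
  shows "a \<otimes> b = b \<otimes> a"
  using assms by (auto simp: mem_generate_singleton nat_pow_mult add.commute)

lemma generate_singleton_normal: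
  assumes "finite (carrier G)" "y \<in> carrier G" "\<And>g. g \<in> carrier G \<Longrightarrow> g \<otimes> y \<otimes> inv g \<in> generate G {y}"
  shows "generate G {y} \<lhd> G"
proof (rule normal_invI[OF generate_singleton_subgroup[OF assms(2)]])
  fix g h assume g: "g \<in> carrier G" and h: "h \<in> generate G {y}"
  then obtain k :: nat where "h = y [^] k" using assms mem_generate_singleton by auto
  then have "g \<otimes> h \<otimes> inv g = (g \<otimes> y \<otimes> inv g) [^] k" using g assms by (simp add: conj_pow)
  moreover obtain j :: nat where "g \<otimes> y \<otimes> inv g = y [^] j" using assms g mem_generate_singleton by metis
  ultimately show "g \<otimes> h \<otimes> inv g \<in> generate G {y}" using assms by (auto simp: mem_generate_singleton nat_pow_pow)
qed

lemma pow_index_mem: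
  assumes "N \<lhd> G" "x \<in> carrier G"
  shows "x [^] card (rcosets N) \<in> N"
proof -
  interpret N: normal N G by fact
  interpret Q: group "G Mod N" by (rule N.factorgroup_is_group)
  have "(N #> x) [^]\<^bsub>G Mod N\<^esub> order (G Mod N) = \<one>\<^bsub>G Mod N\<^esub>"
    using assms by (intro Q.pow_order_eq_1) (auto simp: carrier_FactGroup)
  then have "N #> (x [^] card (rcosets N)) = N"
    using assms N.FactGroup_pow[of x] by (simp add: order_def FactGroup_def)
  then show ?thesis using assms by (metis N.rcos_const coset_join1 N.subset nat_pow_closed N.subgroup_axioms)
qed

lemma pow_index_mem_comm:
  assumes "finite (carrier G)" "x \<in> carrier G" "subgroup M G" "M \<subseteq> generate G {x}" "card (generate G {x}) = t * card M" "c \<in> generate G {x}"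
  shows "c [^] t \<in> M"
proof -
  let ?C = "G\<lparr>carrier := generate G {x}\<rparr>"
  have sg: "subgroup (generate G {x}) G" using assms generate_singleton_subgroup by auto
  interpret C: group ?C by (rule subgroup_imp_group[OF sg])
  interpret C: comm_group ?C
    by (rule C.group_comm_groupI) (use generate_singleton_comm[OF assms(1,2)] in auto)
  have M: "M \<lhd> ?C" using C.normal_iff_subgroup subgroup_incl[OF assms(3) sg assms(4)] by auto
  have "card M > 0" using assms subgroup.one_closed[OF assms(3)] finite_subset[OF subgroup.subset[OF assms(3)]] by (auto simp: card_gt_0_iff)
  moreover have "card (rcosets\<^bsub>?C\<^esub> M) * card M = t * card M"
    using C.lagrange[OF normal_imp_subgroup[OF M]] assms(5) by (simp add: order_def)
  ultimately have "card (rcosets\<^bsub>?C\<^esub> M) = t" by simp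
  with C.pow_index_mem[OF M, of c] assms show ?thesis by (simp add: nat_pow_consistent[symmetric])
qed

end

text \<open>Cosets have type \<open>'a set\<close>, so iterated quotients would change type at every
  step. The finite quotient is therefore copied along an injection \<open>e\<close> into
  \<open>nat\<close>, with \<open>d\<close> as its inverse on the image.\<close>

lemma (in group) quotient_on_nat:
  assumes "finite (carrier G)" "N \<lhd> G"
  obtains H :: "nat monoid" and h where "group H" "group_hom G H h" "h ` carrier G = carrier H" "kernel G H h = N"
    "order G = order H * card N" "finite (carrier H)"
proof -
  interpret N: normal N G by fact
  interpret Q: group "G Mod N" by (rule N.factorgroup_is_group)
  have fQ: "finite (carrier (G Mod N))" using assms by (auto simp: carrier_FactGroup)
  then obtain e :: "'a set \<Rightarrow> nat" where e: "inj_on e (carrier (G Mod N))"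
    using finite_imp_inj_to_nat_seg by blast
  define d where "d = the_inv_into (carrier (G Mod N)) e"
  have de: "d (e q) = q" if "q \<in> carrier (G Mod N)" for q using that e by (simp add: d_def the_inv_into_f_f)
  define H where "H = \<lparr>carrier = e ` carrier (G Mod N), monoid.mult = \<lambda>x y. e (d x \<otimes>\<^bsub>G Mod N\<^esub> d y), monoid.one = e \<one>\<^bsub>G Mod N\<^esub>\<rparr>"
  have grp: "group H"
  proof (rule groupI)
    show "\<exists>y\<in>carrier H. y \<otimes>\<^bsub>H\<^esub> x = \<one>\<^bsub>H\<^esub>" if x: "x \<in> carrier H" for x
    proof -
      have "x \<in> e ` carrier (G Mod N)" using x by (simp add: H_def)
      then obtain q where q: "q \<in> carrier (G Mod N)" "x = e q" by (rule imageE)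
      then show ?thesis unfolding H_def
        by (intro bexI[of _ "e (inv\<^bsub>G Mod N\<^esub> q)"]) (simp_all add: de del: mult_FactGroup one_FactGroup)
    qed
  qed (auto simp: H_def de Q.m_assoc simp del: mult_FactGroup one_FactGroup)
  interpret H: group H by fact
  define h where "h = (\<lambda>x. e (N #> x))"
  have cQ: "N #> x \<in> carrier (G Mod N)" if "x \<in> carrier G" for x using that by (auto simp: carrier_FactGroup)
  have hom: "group_hom G H h"
  proof (unfold_locales, rule homI)
    show "h x \<in> carrier H" if "x \<in> carrier G" for x using that cQ by (auto simp: h_def H_def)
    show "h (x \<otimes> y) = h x \<otimes>\<^bsub>H\<^esub> h y" if "x \<in> carrier G" "y \<in> carrier G" for x y
      using that by (simp add: h_def H_def de cQ N.rcos_sum)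
  qed
  have surj: "h ` carrier G = carrier H" by (auto simp: h_def H_def carrier_FactGroup)
  have ker: "kernel G H h = N"
  proof -
    have "h x = \<one>\<^bsub>H\<^esub> \<longleftrightarrow> x \<in> N" if "x \<in> carrier G" for x
    proof -
      have "h x = \<one>\<^bsub>H\<^esub> \<longleftrightarrow> N #> x = N"
        using that cQ[OF that] cQ[of \<one>] Q.one_closed unfolding h_def H_def by (auto simp: inj_on_eq_iff[OF e])
      then show ?thesis using that coset_join1 coset_join2 N.subgroup_axioms N.subset by metis
    qed
    then show ?thesis using N.subset by (auto simp: kernel_def)
  qed
  have "order H = card (rcosets N)" unfolding order_def H_def by (simp add: card_image[OF e]) (simp add: FactGroup_def)
  then have "order G = order H * card N" using lagrange[OF N.subgroup_axioms] by simp
  then show thesis using that[OF grp hom surj ker] fQ by (simp add: H_def)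
qed

section \<open>Element orders modulo a normal cyclic subgroup\<close>

context group
begin

text \<open>One exponent \<open>r\<close> serves the whole subgroup. Two conjugations therefore act
  as power maps, and these commute.\<close>

lemma normal_cyclic_conj:
  assumes "finite (carrier G)" "y \<in> carrier G" "generate G {y} \<lhd> G" "x \<in> carrier G"
  shows "\<exists>r::nat. \<forall>z\<in>generate G {y}. inv x \<otimes> z \<otimes> x = z [^] r"
proof -
  interpret P: normal "generate G {y}" G by fact
  have "y \<in> generate G {y}" by (rule generate.incl) simp
  then have "inv x \<otimes> y \<otimes> x \<in> generate G {y}" using assms P.inv_op_closed1 by blast
  then obtain r :: nat where r: "inv x \<otimes> y \<otimes> x = y [^] r" using assms mem_generate_singleton by auto
  have "inv x \<otimes> z \<otimes> x = z [^] r" if z: "z \<in> generate G {y}" for z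
  proof -
    obtain k :: nat where k: "z = y [^] k" using assms z mem_generate_singleton by auto
    have "inv x \<otimes> y [^] k \<otimes> x = (inv x \<otimes> y \<otimes> x) [^] k" using conj_pow[of "inv x" y k] assms by simp
    then show ?thesis using k r assms by (simp add: nat_pow_pow mult.commute)
  qed
  then show ?thesis by blast
qed

text \<open>Moving \<open>x\<close> leftwards across a power of \<open>z\<close> only changes the
  exponent of \<open>z\<close>.\<close>

lemma pow_mult_normal_cyclic:
  assumes "finite (carrier G)" "y \<in> carrier G" "generate G {y} \<lhd> G" "x \<in> carrier G" "z \<in> generate G {y}"
  shows "\<exists>s::nat. (x \<otimes> z) [^] (k::nat) = x [^] k \<otimes> z [^] s"
proof (induction k)
  case 0 show ?case using assms by (intro exI[of _ 0]) simp
next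
  case (Suc k)
  then obtain s :: nat where s: "(x \<otimes> z) [^] k = x [^] k \<otimes> z [^] s" by blast
  interpret P: normal "generate G {y}" G by fact
  have z: "z \<in> carrier G" using assms P.subset by auto
  obtain r :: nat where r: "inv x \<otimes> z \<otimes> x = z [^] r" using normal_cyclic_conj[OF assms(1-4)] assms(5) by blast
  have "inv x \<otimes> z [^] s \<otimes> x = (inv x \<otimes> z \<otimes> x) [^] s" using conj_pow[of "inv x" z s] assms z by simp
  then have e: "z [^] s \<otimes> x = x \<otimes> z [^] (r * s)" using r assms z
    by (simp add: nat_pow_pow m_assoc inv_solve_left')
  have "(x \<otimes> z) [^] Suc k = x [^] k \<otimes> (z [^] s \<otimes> x) \<otimes> z" using s assms z by (simp add: m_assoc)
  also have "\<dots> = x [^] Suc k \<otimes> z [^] Suc (r * s)" unfolding e using assms z by (simp add: m_assoc)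
  finally show ?case by blast
qed

end

text \<open>Take any preimage \<open>x0\<close> and raise it to a power \<open>u\<close> that is
  divisible by \<open>ord y\<close> and congruent to 1 modulo \<open>ord w\<close>. The congruence
  keeps the image equal to \<open>w\<close>. The divisibility kills \<open>x0 [^] ord w\<close>,
  which lies in the kernel.\<close>

lemma (in group_hom) exists_lift_pow_eq_one:
  assumes "finite (carrier G)" "h ` carrier G = carrier H" "y \<in> carrier G" "kernel G H h = generate G {y}"
    and "coprime (G.ord y) (order H)" "w \<in> carrier H"
  obtains x where "x \<in> carrier G" "h x = w" "x [^] H.ord w = \<one>"
proof -
  obtain x0 where x0: "x0 \<in> carrier G" "h x0 = w" using assms(2,6) by (metis imageE)
  let ?m = "H.ord w" and ?q = "G.ord y"
  have "coprime ?q ?m" by (rule coprime_divisors[OF dvd_refl H.ord_dvd_group_order[OF assms(6)] assms(5)])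
  then obtain v where v: "[?q * v = Suc 0] (mod ?m)" using cong_solve_coprime_nat by blast
  define u where "u = ?q * v"
  have "w [^]\<^bsub>H\<^esub> int u = w [^]\<^bsub>H\<^esub> (1::int)"
  proof -
    have "[int u = int 1] (mod int ?m)" using v unfolding u_def cong_int_iff by simp
    then have "int ?m dvd 1 - int u" by (simp add: cong_iff_dvd_diff dvd_diff_commute)
    then show ?thesis by (simp only: H.int_pow_eq[OF assms(6)])
  qed
  then have "w [^]\<^bsub>H\<^esub> u = w" using assms(6) H.int_pow_1[of w] by (simp add: int_pow_int)
  then have hx: "h (x0 [^] u) = w" using x0 by (simp add: hom_nat_pow)
  have "h (x0 [^] ?m) = \<one>\<^bsub>H\<^esub>" using x0 assms(6) by (simp add: hom_nat_pow)
  then have "x0 [^] ?m \<in> generate G {y}" using x0 assms(4) by (auto simp: kernel_def)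
  then obtain k :: nat where k: "x0 [^] ?m = y [^] k" using G.mem_generate_singleton[OF assms(1,3)] by auto
  have "(x0 [^] u) [^] ?m = (x0 [^] ?m) [^] u" using x0 by (simp add: G.nat_pow_pow mult.commute)
  also have "\<dots> = (y [^] ?q) [^] (k * v)" unfolding k u_def using assms(3) by (simp add: G.nat_pow_pow mult_ac del: G.pow_ord_eq_1)
  also have "\<dots> = \<one>" using assms(3) by simp
  finally show thesis using that[of "x0 [^] u"] hx x0 by auto
qed

text \<open>The fibre over \<open>w\<close> is \<open>xP\<close>, where \<open>x\<close> is a lift
  with \<open>x [^] ord w = 1\<close>. Then the power of \<open>x \<otimes> z\<close> with exponent
  \<open>ord w\<close> is a power of \<open>z\<close>, so the order of \<open>x \<otimes> z\<close>
  divides \<open>ord w * ord z\<close>; summing over \<open>z\<close> and \<open>w\<close> gives the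
  product.\<close>

lemma (in group_hom) psi_le:
  assumes "finite (carrier G)" "h ` carrier G = carrier H" "y \<in> carrier G" "kernel G H h = generate G {y}"
    and "coprime (G.ord y) (order H)"
  shows "psi G \<le> (\<Sum>z\<in>generate G {y}. G.ord z) * psi H"
proof -
  let ?P = "generate G {y}"
  have P: "?P \<lhd> G" using normal_kernel assms(4) by simp
  interpret P: normal ?P G by fact
  have fH: "finite (carrier H)" using assms by (metis finite_imageI)
  have fib: "(\<Sum>x\<in>{x\<in>carrier G. h x = w}. G.ord x) \<le> (\<Sum>z\<in>?P. G.ord z) * H.ord w" if w: "w \<in> carrier H" for w
  proof -
    obtain x where x: "x \<in> carrier G" "h x = w" "x [^] H.ord w = \<one>"
      using exists_lift_pow_eq_one[OF assms w] by blast
    have "bij_betw (\<lambda>z. x \<otimes> z) ?P {x\<in>carrier G. h x = w}"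
    proof (rule bij_betwI[where g = "\<lambda>z. inv x \<otimes> z"])
      have mem: "z \<in> ?P \<longleftrightarrow> z \<in> carrier G \<and> h z = \<one>\<^bsub>H\<^esub>" for z
        unfolding assms(4)[symmetric] by (simp add: kernel_def)
      show "(\<lambda>z. x \<otimes> z) \<in> ?P \<rightarrow> {x\<in>carrier G. h x = w}"
        using x(1,2) w by (intro funcsetI) (simp add: mem)
      show "(\<lambda>z. inv x \<otimes> z) \<in> {x\<in>carrier G. h x = w} \<rightarrow> ?P"
        using x(1,2) w by (intro funcsetI) (simp add: mem)
      show "inv x \<otimes> (x \<otimes> z) = z" if "z \<in> ?P" for z
        using that x(1) by (simp add: mem G.m_assoc[symmetric])
      show "x \<otimes> (inv x \<otimes> z) = z" if "z \<in> {x\<in>carrier G. h x = w}" for z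
        using that x(1) by (simp add: G.m_assoc[symmetric])
    qed
    then have "(\<Sum>x\<in>{x\<in>carrier G. h x = w}. G.ord x) = (\<Sum>z\<in>?P. G.ord (x \<otimes> z))"
      by (rule sum.reindex_bij_betw[symmetric])
    also have "\<dots> \<le> (\<Sum>z\<in>?P. G.ord z * H.ord w)"
    proof (rule sum_mono)
      fix z assume z: "z \<in> ?P"
      then have zc: "z \<in> carrier G" using P.subset by auto
      obtain s :: nat where s: "(x \<otimes> z) [^] H.ord w = x [^] H.ord w \<otimes> z [^] s"
        using G.pow_mult_normal_cyclic[OF assms(1,3) P x(1) z] by blast
      have "(x \<otimes> z) [^] (H.ord w * G.ord z) = (z [^] s) [^] G.ord z"
        using s x zc by (simp add: G.nat_pow_pow[symmetric])
      also have "\<dots> = (z [^] G.ord z) [^] s" using zc by (simp add: G.nat_pow_pow mult.commute del: G.pow_ord_eq_1)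
      finally have "G.ord (x \<otimes> z) dvd H.ord w * G.ord z" using zc x by (simp add: G.pow_eq_id)
      moreover have "H.ord w * G.ord z > 0" using H.ord_ge_1[OF fH w] G.ord_ge_1[OF assms(1) zc] by simp
      ultimately show "G.ord (x \<otimes> z) \<le> G.ord z * H.ord w" by (simp add: dvd_imp_le mult.commute)
    qed
    finally show ?thesis by (simp add: sum_distrib_right)
  qed
  have "psi G = (\<Sum>w\<in>carrier H. \<Sum>x\<in>{x\<in>carrier G. h x = w}. G.ord x)"
    unfolding psi_def using assms fH by (intro sum.group[symmetric]) auto
  also have "\<dots> \<le> (\<Sum>w\<in>carrier H. (\<Sum>z\<in>?P. G.ord z) * H.ord w)" by (intro sum_mono fib)
  finally show ?thesis by (simp add: psi_def sum_distrib_left)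
qed

text \<open>Generators have order p^a, all other elements order at most b = p^(a-1). With totient
  b(p-1) the resulting estimate is b^2 (p^2 - p + 1), which is the right-hand side; this is the
  origin of the factor in \<open>excess\<close>.\<close>

lemma (in group) sum_ord_cyclic_le:
  assumes "finite (carrier G)" "y \<in> carrier G" "ord y = p ^ a" "a > 0" "Factorial_Ring.prime p"
  shows "real (\<Sum>z\<in>generate G {y}. ord z)
    \<le> real (p ^ a) * real (totient (p ^ a)) * (1 + 1 / (real p * (real p - 1)))"
proof -
  have p: "p > 1" using assms(5) prime_gt_1_nat by auto
  define b where "b = p ^ (a - 1)"
  have pa: "p ^ a = p * b" using assms(4) by (cases a) (auto simp: b_def)
  have tot: "totient (p ^ a) = b * (p - 1)" using totient_prime_power[OF assms(5,4)] by (simp add: b_def)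
  have inj: "inj_on (\<lambda>k. y [^] k) {1..p^a}" using ord_inj'[OF assms(2)] assms(3) by simp
  have im: "(\<lambda>k. y [^] k) ` {1..p^a} = generate G {y}"
  proof (rule card_subset_eq)
    show "finite (generate G {y})" using assms finite_subset[OF subgroup.subset[OF generate_singleton_subgroup]] by blast
    show "(\<lambda>k. y [^] k) ` {1..p^a} \<subseteq> generate G {y}" using assms by (auto simp: mem_generate_singleton)
    show "card ((\<lambda>k. y [^] k) ` {1..p^a}) = card (generate G {y})"
      using card_image[OF inj] generate_pow_card[OF assms(2)] assms(3) by simp
  qed
  have "(\<Sum>z\<in>generate G {y}. ord z) = (\<Sum>k\<in>{1..p^a}. ord (y [^] k))"
    unfolding im[symmetric] using sum.reindex[OF inj, of ord] by simp
  also have "\<dots> \<le> (\<Sum>k\<in>{1..p^a}. b + (if k \<in> totatives (p^a) then p^a - b else 0))"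
  proof (rule sum_mono)
    fix k assume k: "k \<in> {1..p^a}"
    have o: "ord (y [^] k) = p ^ a div gcd (p ^ a) k" using ord_pow_gen[OF assms(2), of k] k assms(3) by auto
    show "ord (y [^] k) \<le> b + (if k \<in> totatives (p^a) then p^a - b else 0)"
    proof (cases "k \<in> totatives (p^a)")
      case True then show ?thesis using o pa p by (simp add: totatives_def)
    next
      case False
      then have "\<not> coprime k (p^a)" using k by (auto simp: totatives_def)
      then have "p dvd k" using assms(5) by (metis coprime_commute coprime_power_left_iff prime_imp_coprime)
      then have "p dvd gcd (p^a) k" using assms(4) by (auto simp: dvd_power)
      then have "p \<le> gcd (p^a) k" using k by (intro dvd_imp_le) (auto simp: gcd_pos_nat)
      then have "p ^ a div gcd (p ^ a) k \<le> p ^ a div p" using p by (intro div_le_mono2) auto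
      then show ?thesis using False o pa p by simp
    qed
  qed
  also have "\<dots> = p^a * b + (\<Sum>k\<in>{1..p^a}. if k \<in> totatives (p^a) then p^a - b else 0)"
    by (simp add: sum.distrib)
  also have "(\<Sum>k\<in>{1..p^a}. if k \<in> totatives (p^a) then p^a - b else 0) = (\<Sum>k\<in>totatives (p^a). p^a - b)"
    by (rule sum.mono_neutral_cong_right) (auto simp: totatives_def)
  also have "\<dots> = totient (p^a) * (p^a - b)" by (simp add: totient_def)
  finally have "real (\<Sum>z\<in>generate G {y}. ord z) \<le> real (p^a * b + totient (p^a) * (p^a - b))" by linarith
  also have "\<dots> = real (p ^ a) * real (totient (p ^ a)) * (1 + 1 / (real p * (real p - 1)))"
  proof -
    have "p * b - b = b * (p - 1)" by (simp add: diff_mult_distrib2 mult.commute)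
    then show ?thesis unfolding tot unfolding pa using p
      by (simp add: of_nat_diff field_simps power2_eq_square)
  qed
  finally show ?thesis .
qed

section \<open>Transfer into a central subgroup\<close>

text \<open>The transfer is a homomorphism from \<open>G\<close> to the abelian group
  \<open>P\<close>, so it kills the derived subgroup. On an element \<open>z\<close> of the central
  subgroup \<open>P\<close> it takes the value of \<open>z\<close> raised to the index of
  \<open>P\<close>.\<close>

lemma (in group) central_transfer:
  assumes "finite (carrier G)" "subgroup P G" "\<forall>z\<in>P. \<forall>x\<in>carrier G. x \<otimes> z = z \<otimes> x"
    and "z \<in> derived G (carrier G)" "z \<in> P"
  shows "z [^] card (rcosets P) = \<one>"
proof -
  let ?A = "G\<lparr>carrier := P\<rparr>"
  interpret P: subgroup P G by fact
  interpret A: group ?A by (rule subgroup_imp_group[OF assms(2)])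
  interpret A: comm_group ?A
    by (rule A.group_comm_groupI) (use assms(3) P.subset in auto)
  define R where "R = rcosets P"
  have finR: "finite R" using assms finite_subset[OF rcosets_subset_PowG[OF assms(2)]] by (auto simp: R_def)
  define r where "r = (\<lambda>V. SOME x. x \<in> V \<and> x \<in> carrier G)"
  have r: "r V \<in> V" "r V \<in> carrier G" "V = P #> r V" if V: "V \<in> R" for V
  proof -
    obtain x where x: "x \<in> carrier G" "V = P #> x" using V by (auto simp: R_def RCOSETS_def)
    then have "x \<in> V \<and> x \<in> carrier G" using rcos_self[OF x(1) assms(2)] by simp
    then have *: "r V \<in> V \<and> r V \<in> carrier G" unfolding r_def by (rule someI)
    then show "r V \<in> V" "r V \<in> carrier G" by auto
    show "V = P #> r V" using * x repr_independence[OF _ x(1) assms(2)] by auto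
  qed
  have VR: "V #> h \<in> R" if "V \<in> R" "h \<in> carrier G" for V h
  proof -
    have "V #> h = P #> (r V \<otimes> h)"
      using r[OF that(1)] that(2) coset_mult_assoc[OF P.subset, of "r V" h] by simp
    then show ?thesis using r[OF that(1)] that by (auto simp: R_def RCOSETS_def)
  qed
  \<comment> \<open>The factor in \<open>P\<close> by which \<open>r V \<otimes> h\<close> differs
    from the chosen representative of \<open>V #> h\<close>. It satisfies
    \<open>f (h \<otimes> k) V = f h V \<otimes> f k (V #> h)\<close>, and since right
    multiplication by \<open>h\<close> permutes the cosets, the product over all \<open>V\<close> is
    multiplicative.\<close>
  define f where "f = (\<lambda>h V. r V \<otimes> h \<otimes> inv (r (V #> h)))"
  have fP: "f h V \<in> P" if "V \<in> R" "h \<in> carrier G" for h V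
  proof -
    have "V #> h = P #> (r V \<otimes> h)"
      using r[OF that(1)] that(2) coset_mult_assoc[OF P.subset, of "r V" h] by simp
    then have "P #> (r V \<otimes> h) = P #> r (V #> h)" using r(3)[OF VR[OF that]] by simp
    then have "r V \<otimes> h \<in> P #> r (V #> h)"
      using rcos_self[of "r V \<otimes> h" P] r[OF that(1)] that assms(2) by auto
    then have "r V \<otimes> h \<otimes> inv (r (V #> h)) \<in> P"
      using P.rcos_module_imp[OF is_group] r(2)[OF VR[OF that]] by auto
    then show ?thesis by (simp add: f_def)
  qed
  define \<tau> where "\<tau> = (\<lambda>h. finprod ?A (f h) R)"
  have hom: "group_hom G ?A \<tau>"
  proof (unfold_locales, rule homI)
    fix h assume h: "h \<in> carrier G"
    then show "\<tau> h \<in> carrier ?A" unfolding \<tau>_def using fP by (intro A.finprod_closed) auto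
    fix k assume k: "k \<in> carrier G"
    have inj: "inj_on (\<lambda>V. V #> h) R"
    proof (rule inj_on_inverseI[where g = "\<lambda>V. V #> inv h"])
      fix V assume "V \<in> R"
      then have "V \<subseteq> carrier G" using rcosets_subset_PowG[OF assms(2)] by (auto simp: R_def)
      then show "V #> h #> inv h = V" using h by (simp add: coset_mult_assoc)
    qed
    have im: "(\<lambda>V. V #> h) ` R = R"
      by (rule endo_inj_surj[OF finR _ inj]) (use VR h in auto)
    have "\<tau> k = finprod ?A (f k) ((\<lambda>V. V #> h) ` R)" by (simp add: \<tau>_def im)
    also have "\<dots> = finprod ?A (\<lambda>V. f k (V #> h)) R"
      using fP k im inj by (intro A.finprod_reindex) auto
    finally have "\<tau> h \<otimes>\<^bsub>?A\<^esub> \<tau> k = finprod ?A (\<lambda>V. f h V \<otimes>\<^bsub>?A\<^esub> f k (V #> h)) R"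
      unfolding \<tau>_def using fP h k VR by (subst A.finprod_multf) auto
    also have "\<dots> = finprod ?A (f (h \<otimes> k)) R"
    proof (rule A.finprod_cong')
      show "f (h \<otimes> k) \<in> R \<rightarrow> carrier ?A" using fP h k by auto
      fix V assume V: "V \<in> R"
      have "V \<subseteq> carrier G" using V rcosets_subset_PowG[OF assms(2)] by (auto simp: R_def)
      then have e: "V #> (h \<otimes> k) = V #> h #> k" using h k by (simp add: coset_mult_assoc)
      have c: "r V \<in> carrier G" "r (V #> h) \<in> carrier G" "r (V #> h #> k) \<in> carrier G"
        using r VR V h k by auto
      have "f h V \<otimes> f k (V #> h) = r V \<otimes> h \<otimes> (inv (r (V #> h)) \<otimes> r (V #> h)) \<otimes> k \<otimes> inv (r (V #> h #> k))"
        unfolding f_def using c h k by (simp only: m_assoc inv_closed m_closed)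
      also have "\<dots> = f (h \<otimes> k) V" unfolding f_def e using c h k by (simp add: m_assoc)
      finally show "f h V \<otimes>\<^bsub>?A\<^esub> f k (V #> h) = f (h \<otimes> k) V" by simp
    qed simp
    finally show "\<tau> (h \<otimes> k) = \<tau> h \<otimes>\<^bsub>?A\<^esub> \<tau> k" by (simp add: \<tau>_def)
  qed
  have "\<tau> z \<in> \<tau> ` derived G (carrier G)" using assms by auto
  also have "\<dots> = derived ?A (\<tau> ` carrier G)" using group_hom.derived_img[OF hom subset_refl] by simp
  also have "\<dots> = {\<one>}"
    using A.derived_eq_singleton[of "\<tau> ` carrier G"] group_hom.hom_closed[OF hom] by auto
  finally have t1: "\<tau> z = \<one>" by simp
  have zc: "z \<in> carrier G" using assms P.subset by auto
  \<comment> \<open>A central element of \<open>P\<close> fixes every coset, so each factor of the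
    transfer equals \<open>z\<close>.\<close>
  have "\<tau> z = finprod ?A (\<lambda>V. z) R" unfolding \<tau>_def
  proof (rule A.finprod_cong')
    show "(\<lambda>V. z) \<in> R \<rightarrow> carrier ?A" using assms by auto
    fix V assume V: "V \<in> R"
    have "V #> z = P #> (r V \<otimes> z)"
      using r[OF V] zc coset_mult_assoc[OF P.subset, of "r V" z] by simp
    also have "r V \<otimes> z = z \<otimes> r V" using assms r[OF V] by auto
    also have "P #> (z \<otimes> r V) = P #> z #> r V" using coset_mult_assoc[OF P.subset zc r(2)[OF V]] by simp
    also have "P #> z = P" using coset_join2[OF zc assms(2,5)] .
    finally have "V #> z = V" using r[OF V] by simp
    moreover have "r V \<otimes> z = z \<otimes> r V" using assms r[OF V] by auto
    ultimately show "f z V = z" using r[OF V] zc by (simp add: f_def m_assoc)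
  qed simp
  also have "\<dots> = z [^] card R"
    using A.finprod_const[of z R] assms by (simp add: nat_pow_consistent[symmetric])
  finally show ?thesis using t1 by (simp add: R_def)
qed

section \<open>Lifting the centrality of the second derived subgroup\<close>

lemma (in group) centralizer_subgroup:
  assumes "y \<in> carrier G"
  shows "subgroup {x \<in> carrier G. x \<otimes> y = y \<otimes> x} G"
proof (rule subgroupI)
  show "{x \<in> carrier G. x \<otimes> y = y \<otimes> x} \<noteq> {}" using assms by (auto intro!: exI[of _ \<one>])
  fix a assume a: "a \<in> {x \<in> carrier G. x \<otimes> y = y \<otimes> x}"
  then have ac: "a \<in> carrier G" and ay: "a \<otimes> y = y \<otimes> a" by auto
  have "inv a \<otimes> y = inv a \<otimes> (y \<otimes> a) \<otimes> inv a" using ac assms by (simp add: m_assoc)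
  also have "\<dots> = inv a \<otimes> (a \<otimes> y) \<otimes> inv a" using ay by simp
  also have "\<dots> = y \<otimes> inv a" using ac assms by (simp add: m_assoc[symmetric])
  finally show "inv a \<in> {x \<in> carrier G. x \<otimes> y = y \<otimes> x}" using a by simp
  fix b assume b: "b \<in> {x \<in> carrier G. x \<otimes> y = y \<otimes> x}"
  have "a \<otimes> b \<otimes> y = a \<otimes> (y \<otimes> b)" using a b assms by (simp add: m_assoc)
  also have "\<dots> = y \<otimes> a \<otimes> b" using a b assms by (simp add: m_assoc[symmetric])
  finally show "a \<otimes> b \<in> {x \<in> carrier G. x \<otimes> y = y \<otimes> x}" using a b assms by (simp add: m_assoc)
qed auto

text \<open>Conjugations act on a normal cyclic subgroup as power maps, and power maps commute. So
  \<open>ab\<close> and \<open>ba\<close> act in the same way on \<open>y\<close>, and their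
  quotient, the commutator, fixes \<open>y\<close>.\<close>

lemma (in group) derived_centralizes_normal_cyclic:
  assumes "finite (carrier G)" "y \<in> carrier G" "generate G {y} \<lhd> G"
  shows "derived G (carrier G) \<subseteq> {x \<in> carrier G. x \<otimes> y = y \<otimes> x}"
  unfolding derived_def
proof (rule generate_subgroup_incl[OF _ centralizer_subgroup[OF assms(2)]])
  interpret P: normal "generate G {y}" G by fact
  have yP: "y \<in> generate G {y}" by (rule generate.incl) simp
  show "derived_set G (carrier G) \<subseteq> {x \<in> carrier G. x \<otimes> y = y \<otimes> x}"
  proof clarify
    fix a b assume ab: "a \<in> carrier G" "b \<in> carrier G"
    obtain r :: nat where r: "\<And>z. z \<in> generate G {y} \<Longrightarrow> inv a \<otimes> z \<otimes> a = z [^] r"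
      using normal_cyclic_conj[OF assms ab(1)] by blast
    obtain s :: nat where s: "\<And>z. z \<in> generate G {y} \<Longrightarrow> inv b \<otimes> z \<otimes> b = z [^] s"
      using normal_cyclic_conj[OF assms ab(2)] by blast
    define u where "u = b \<otimes> a"
    define v where "v = a \<otimes> b"
    have uv: "u \<in> carrier G" "v \<in> carrier G" using ab by (auto simp: u_def v_def)
    have "inv u \<otimes> y \<otimes> u = inv a \<otimes> (inv b \<otimes> y \<otimes> b) \<otimes> a"
      using ab assms unfolding u_def by (simp add: inv_mult_group m_assoc)
    also have "\<dots> = (y [^] s) [^] r"
      unfolding s[OF yP] using yP assms by (intro r) (auto simp: mem_generate_singleton)
    also have "\<dots> = (y [^] r) [^] s" using assms by (simp add: nat_pow_pow mult.commute)
    also have "\<dots> = inv b \<otimes> (inv a \<otimes> y \<otimes> a) \<otimes> b"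
      unfolding r[OF yP] using yP assms by (intro s[symmetric]) (auto simp: mem_generate_singleton)
    also have "\<dots> = inv v \<otimes> y \<otimes> v"
      using ab assms unfolding v_def by (simp add: inv_mult_group m_assoc)
    finally have e: "inv u \<otimes> y \<otimes> u = inv v \<otimes> y \<otimes> v" .
    have c: "a \<otimes> b \<otimes> inv a \<otimes> inv b = v \<otimes> inv u" using ab by (simp add: u_def v_def inv_mult_group m_assoc)
    have "v \<otimes> inv u \<otimes> y = v \<otimes> (inv u \<otimes> y \<otimes> u) \<otimes> inv u"
      using uv assms by (simp add: m_assoc)
    also have "\<dots> = v \<otimes> (inv v \<otimes> y \<otimes> v) \<otimes> inv u" by (simp only: e)
    also have "\<dots> = y \<otimes> (v \<otimes> inv u)" using uv assms by (simp add: m_assoc[symmetric])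
    finally show "a \<otimes> b \<otimes> inv a \<otimes> inv b \<in> carrier G \<and> a \<otimes> b \<otimes> inv a \<otimes> inv b \<otimes> y = y \<otimes> (a \<otimes> b \<otimes> inv a \<otimes> inv b)"
      unfolding c using uv by simp
  qed
qed

lemma (in group_hom) derived2_central_lift:
  assumes "finite (carrier G)" "h ` carrier G = carrier H" "y \<in> carrier G" "kernel G H h = generate G {y}"
    and "coprime (G.ord y) (order H)" "order G = order H * G.ord y"
    and "derived H (derived H (carrier H)) \<subseteq> group_center H"
  shows "derived G (derived G (carrier G)) \<subseteq> group_center G"
proof
  let ?P = "generate G {y}"
  let ?D = "derived G (derived G (carrier G))"
  have P: "?P \<lhd> G" using normal_kernel assms(4) by simp
  interpret P: normal ?P G by fact
  define Z where "Z = {x \<in> carrier G. x \<otimes> y = y \<otimes> x}"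
  have Z: "subgroup Z G" using G.centralizer_subgroup[OF assms(3)] by (simp add: Z_def)
  let ?Z = "G\<lparr>carrier := Z\<rparr>"
  interpret Zg: group ?Z by (rule G.subgroup_imp_group[OF Z])
  have DZ: "derived G (carrier G) \<subseteq> Z" using G.derived_centralizes_normal_cyclic[OF assms(1,3) P] by (simp add: Z_def)
  have PZ: "?P \<subseteq> Z"
    using G.generate_singleton_comm[OF assms(1,3) _ generate.incl[of y "{y}" G]] P.subset by (auto simp: Z_def)
  have PZs: "subgroup ?P ?Z" using G.subgroup_incl[OF P.subgroup_axioms Z PZ] .
  have cent: "\<forall>z\<in>?P. \<forall>x\<in>carrier ?Z. x \<otimes>\<^bsub>?Z\<^esub> z = z \<otimes>\<^bsub>?Z\<^esub> x"
  proof clarsimp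
    fix z x assume z: "z \<in> ?P" and x: "x \<in> Z"
    obtain k :: nat where k: "z = y [^] k" using z G.mem_generate_singleton[OF assms(1,3)] by auto
    have "subgroup {g \<in> carrier G. g \<otimes> x = x \<otimes> g} G" using x by (intro G.centralizer_subgroup) (auto simp: Z_def)
    then have "?P \<subseteq> {g \<in> carrier G. g \<otimes> x = x \<otimes> g}"
      by (rule G.generate_subgroup_incl[rotated]) (use x assms in \<open>auto simp: Z_def\<close>)
    then show "x \<otimes> z = z \<otimes> x" using z by auto
  qed
  \<comment> \<open>The order of \<open>P\<close> is coprime to its index in \<open>G\<close>, hence
    also to its index in the intermediate group \<open>Z\<close>.\<close>
  have cop: "coprime (G.ord y) (card (rcosets\<^bsub>?Z\<^esub> ?P))"
  proof -
    have "card (rcosets\<^bsub>?Z\<^esub> ?P) * G.ord y = card Z"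
      using Zg.lagrange[OF PZs] G.generate_pow_card[OF assms(3)] by (simp add: order_def)
    moreover have "card Z dvd order H * G.ord y" using G.card_subgroup_dvd_order[OF Z] assms(6) by simp
    ultimately have "card (rcosets\<^bsub>?Z\<^esub> ?P) * G.ord y dvd order H * G.ord y" by simp
    then have "card (rcosets\<^bsub>?Z\<^esub> ?P) dvd order H"
      using G.ord_ge_1[OF assms(1,3)] by simp
    then show ?thesis using coprime_divisors[OF dvd_refl _ assms(5)] by blast
  qed
  have Dn: "?D \<lhd> G" using G.derived_is_normal[OF G.derived_self_is_normal] .
  interpret D: normal ?D G by fact
  fix x assume x: "x \<in> ?D"
  have xc: "x \<in> carrier G" using x D.subset by auto
  have hx: "h x \<in> group_center H"
  proof -
    have "h ` ?D = derived H (derived H (h ` carrier G))"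
      using derived_img[OF subset_refl] derived_img[OF G.derived_in_carrier[OF subset_refl]] by simp
    then show ?thesis using x assms(2,7) by auto
  qed
  have "x \<otimes> g = g \<otimes> x" if g: "g \<in> carrier G" for g
  proof -
    \<comment> \<open>The commutator of \<open>x\<close> and \<open>g\<close>. It lies in the second
      derived subgroup by normality, in \<open>P\<close> because \<open>h x\<close> is central, and
      in the derived subgroup of \<open>Z\<close>. By transfer its order divides the index of
      \<open>P\<close> in \<open>Z\<close> as well as the order of \<open>P\<close>, so it is
      trivial.\<close>
    define c where "c = x \<otimes> (g \<otimes> inv x \<otimes> inv g)"
    have cc: "c \<in> carrier G" using xc g by (simp add: c_def)
    have cD: "c \<in> ?D" unfolding c_def using x g by (intro D.m_closed D.inv_op_closed2) auto
    have "h x \<otimes>\<^bsub>H\<^esub> h g = h g \<otimes>\<^bsub>H\<^esub> h x" using hx g by (auto simp: group_center_def)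
    then have "h c = \<one>\<^bsub>H\<^esub>" unfolding c_def using xc g
      by (simp add: H.m_assoc[symmetric]) (simp add: H.m_assoc)
    then have cP: "c \<in> ?P" using cc unfolding assms(4)[symmetric] by (simp add: kernel_def)
    have "c \<in> derived ?Z (carrier ?Z)"
      using cD G.mono_derived[OF DZ] G.derived_consistent[OF subset_refl Z] by auto
    then have "c [^] card (rcosets\<^bsub>?Z\<^esub> ?P) = \<one>"
      using Zg.central_transfer[OF _ PZs cent _ cP] assms(1) finite_subset[of Z "carrier G"]
      by (auto simp: G.nat_pow_consistent[symmetric] Z_def)
    then have 1: "G.ord c dvd card (rcosets\<^bsub>?Z\<^esub> ?P)" using cc by (simp add: G.pow_eq_id)
    obtain k :: nat where k: "c = y [^] k" using cP G.mem_generate_singleton[OF assms(1,3)] by auto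
    have "c [^] G.ord y = (y [^] G.ord y) [^] k"
      unfolding k using assms(3) by (simp only: G.nat_pow_pow mult.commute)
    then have 2: "G.ord c dvd G.ord y" using cc assms(3) by (simp add: G.pow_eq_id[symmetric])
    have "G.ord c = 1" using 1 2 cop by (metis coprime_common_divisor_nat)
    then have "c = \<one>" using G.ord_eq_1[OF cc] by simp
    then have "x \<otimes> (g \<otimes> inv x \<otimes> inv g) \<otimes> g \<otimes> x = g \<otimes> x" using xc g by (simp add: c_def)
    then show ?thesis using xc g by (simp add: G.m_assoc)
  qed
  then show "x \<in> group_center G" using xc by (simp add: group_center_def)
qed

section \<open>Cyclic subgroups of prime index\<close>

lemma (in group) prime_order_comm:
  assumes "Factorial_Ring.prime (order G)" "a \<in> carrier G" "b \<in> carrier G"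
  shows "a \<otimes> b = b \<otimes> a"
proof (cases "a = \<one>")
  case False
  have fin: "finite (carrier G)" using prime_gt_0_nat[OF assms(1)] order_gt_0_iff_finite by simp
  have "ord a = order G" using ord_dvd_group_order[OF assms(2)] assms(1) ord_eq_1[OF assms(2)] False
    by (auto simp: prime_nat_iff)
  then have "generate G {a} = carrier G"
    using generate_pow_card[OF assms(2)] fin subgroup.subset[OF generate_singleton_subgroup[OF assms(2)]]
    by (intro card_subset_eq) (auto simp: order_def)
  then show ?thesis using generate_singleton_comm[OF fin assms(2)] assms by auto
qed (use assms in auto)

text \<open>Two elements that do not commute would give five distinct elements 1, a, b, ab,
  ba.\<close>

lemma (in group) order_le_4_comm:
  assumes "finite (carrier G)" "order G \<le> 4" "a \<in> carrier G" "b \<in> carrier G"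
  shows "a \<otimes> b = b \<otimes> a"
proof (rule ccontr)
  assume n: "a \<otimes> b \<noteq> b \<otimes> a"
  have 1: "a \<noteq> \<one>" "b \<noteq> \<one>" "a \<noteq> b" using n assms by auto
  have 2: "a \<otimes> b \<noteq> a" "a \<otimes> b \<noteq> b" "b \<otimes> a \<noteq> a" "b \<otimes> a \<noteq> b" using 1 assms by auto
  have 3: "a \<otimes> b \<noteq> \<one>" "b \<otimes> a \<noteq> \<one>" using n assms by (metis inv_comm)+
  have "card {\<one>, a, b, a \<otimes> b, b \<otimes> a} = 5"
    using n 1 2 3 1(1,2)[symmetric] 2[symmetric] 3[symmetric] by (simp del: r_cancel_one r_cancel_one' l_cancel_one l_cancel_one')
  moreover have "card {\<one>, a, b, a \<otimes> b, b \<otimes> a} \<le> order G" unfolding order_def using assms by (intro card_mono) auto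
  ultimately show False using assms by simp
qed

lemma (in group) derived_subset_small_index:
  assumes "finite (carrier G)" "N \<lhd> G" "Factorial_Ring.prime (card (rcosets N)) \<or> card (rcosets N) \<le> 4"
  shows "derived G (carrier G) \<subseteq> N"
proof (rule derived_minimal[OF assms(2)])
  interpret Q: group "G Mod N" by (rule normal.factorgroup_is_group[OF assms(2)])
  have f: "finite (carrier (G Mod N))" using assms by (auto simp: carrier_FactGroup)
  have o: "order (G Mod N) = card (rcosets N)" by (simp add: order_def FactGroup_def)
  show "comm_group (G Mod N)"
    by (rule Q.group_comm_groupI) (use Q.prime_order_comm Q.order_le_4_comm[OF f] assms(3) o in metis)
qed

lemma (in group) derived_trivial_of_comm:
  assumes "K \<subseteq> carrier G" "\<And>a b. a \<in> K \<Longrightarrow> b \<in> K \<Longrightarrow> a \<otimes> b = b \<otimes> a"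
  shows "derived G K \<subseteq> {\<one>}"
  unfolding derived_def
proof (rule generate_subgroup_incl[OF _ triv_subgroup])
  show "derived_set G K \<subseteq> {\<one>}"
  proof clarsimp
    fix a b assume ab: "a \<in> K" "b \<in> K"
    then have c: "a \<in> carrier G" "b \<in> carrier G" using assms by auto
    have "a \<otimes> b \<otimes> inv a \<otimes> inv b = b \<otimes> a \<otimes> inv a \<otimes> inv b" using assms(2)[OF ab] by simp
    then show "a \<otimes> b \<otimes> inv a \<otimes> inv b = \<one>" using c by (simp add: m_assoc)
  qed
qed

lemma (in group) derived2_trivial:
  assumes "derived G (carrier G) \<subseteq> K" "K \<subseteq> carrier G" "\<And>a b. a \<in> K \<Longrightarrow> b \<in> K \<Longrightarrow> a \<otimes> b = b \<otimes> a"
  shows "derived G (derived G (carrier G)) \<subseteq> {\<one>}"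
  using mono_derived[OF assms(1)] derived_trivial_of_comm[OF assms(2,3)] by blast

lemma (in group) one_in_center: "{\<one>} \<subseteq> group_center G"
  by (auto simp: group_center_def)

text \<open>If \<open>R\<close> met a conjugate trivially, the corresponding double coset would have
  \<open>card R * card R\<close> elements, more than \<open>G\<close> has. As \<open>R\<close> has
  prime order, a nontrivial intersection is all of \<open>R\<close>.\<close>

lemma (in group) normal_prime_subgroup:
  assumes "finite (carrier G)" "subgroup R G" "Factorial_Ring.prime (card R)" "order G < card R * card R"
  shows "R \<lhd> G"
proof (rule normal_invI[OF assms(2)])
  fix g r assume g: "g \<in> carrier G" and r: "r \<in> R"
  interpret R: subgroup R G by fact
  have g': "inv g \<in> carrier G" using g by simp
  have finR: "finite R" using assms finite_subset[OF R.subset] by auto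
  have "double_coset R (inv g) \<subseteq> carrier G" using R.subset g by (auto simp: double_coset_def)
  then have "card (double_coset R (inv g)) \<le> order G" unfolding order_def using assms by (intro card_mono) auto
  then have "card (inter_conj R (inv g)) \<noteq> 1" using card_double_coset[OF assms(1,2) g'] assms(4) by auto
  then have "card (inter_conj R (inv g)) = card R"
    using card_subgroup_dvd[OF inter_conj_subgroup[OF assms(2) g'] assms(2) inter_conj_subset] assms(3)
    by (auto simp: prime_nat_iff)
  then have "inter_conj R (inv g) = R" using finR by (intro card_subset_eq inter_conj_subset) auto
  then show "g \<otimes> r \<otimes> inv g \<in> R" using r g by (auto simp: inter_conj_def)
qed

text \<open>The subgroup \<open>R\<close> of order \<open>p\<close> is normal because
  \<open>p t < p^2\<close>. It meets \<open>D\<close> trivially, so \<open>D\<close> maps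
  bijectively onto \<open>G/R\<close>. Hence \<open>G/R\<close> is abelian, and the derived subgroup
  lies in the abelian group \<open>R\<close>.\<close>

lemma (in group) derived2_trivial_of_prime_times_comm:
  assumes "finite (carrier G)" "Factorial_Ring.prime p" "order G = p * t" "0 < t" "t < p"
    and "subgroup D G" "card D = t" "\<And>a b. a \<in> D \<Longrightarrow> b \<in> D \<Longrightarrow> a \<otimes> b = b \<otimes> a"
  shows "derived G (derived G (carrier G)) \<subseteq> {\<one>}"
proof -
  obtain R where R: "subgroup R G" "card R = p" using sylow_thm[OF assms(2) is_group, of 1 t] assms by auto
  have Rn: "R \<lhd> G" using assms R by (intro normal_prime_subgroup) auto
  interpret R: normal R G by fact
  interpret D: subgroup D G by fact
  have fin: "finite D" "finite R" using assms finite_subset[OF D.subset] finite_subset[OF R.subset] by auto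
  have triv: "D \<inter> R \<subseteq> {\<one>}"
  proof
    fix z assume z: "z \<in> D \<inter> R"
    then have zc: "z \<in> carrier G" by auto
    have sg: "subgroup (generate G {z}) G" using zc by (rule generate_singleton_subgroup)
    have "generate G {z} \<subseteq> D" by (rule generate_subgroup_incl[OF _ assms(6)]) (use z in auto)
    from card_subgroup_dvd[OF sg assms(6) this] have d1: "ord z dvd t"
      by (simp add: assms(7) generate_pow_card[OF zc, symmetric])
    have "generate G {z} \<subseteq> R" by (rule generate_subgroup_incl[OF _ R(1)]) (use z in auto)
    from card_subgroup_dvd[OF sg R(1) this] have "ord z dvd p"
      by (simp add: R(2) generate_pow_card[OF zc, symmetric])
    moreover have "ord z \<noteq> p" using dvd_imp_le[OF d1 assms(4)] assms(5) by linarith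
    ultimately have "ord z = 1" using assms(2) unfolding prime_nat_iff by blast
    then show "z \<in> {\<one>}" using ord_eq_1[OF zc] by simp
  qed
  have "card (rcosets R) * p = p * t" using lagrange[OF R(1)] R assms by simp
  then have cR: "card (rcosets R) = t" using assms(4,5) by simp
  have im: "(\<lambda>d. R #> d) ` D = rcosets R"
  proof (rule card_subset_eq)
    show "finite (rcosets R)" using cR assms(4) card_ge_0_finite by metis
    show "(\<lambda>d. R #> d) ` D \<subseteq> rcosets R" using rcosetsI[OF R.subset] by auto
    have "inj_on (\<lambda>d. R #> d) D"
    proof (rule inj_onI)
      fix a b assume ab: "a \<in> D" "b \<in> D" and e: "R #> a = R #> b"
      then have "a \<in> R #> b" using rcos_self[of a R] R(1) by auto
      then have "a \<otimes> inv b \<in> R" using R.rcos_module_imp[OF is_group] ab by auto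
      then have "a \<otimes> inv b = \<one>" using triv ab by auto
      then show "a = b" using ab inv_equality[of a "inv b"] by auto
    qed
    then show "card ((\<lambda>d. R #> d) ` D) = card (rcosets R)" by (simp add: card_image cR assms(7))
  qed
  have "derived G (carrier G) \<subseteq> R"
  proof (rule derived_minimal[OF Rn])
    interpret Q: group "G Mod R" by (rule R.factorgroup_is_group)
    show "comm_group (G Mod R)"
    proof (rule Q.group_comm_groupI)
      fix A B assume "A \<in> carrier (G Mod R)" "B \<in> carrier (G Mod R)"
      then obtain a b where "a \<in> D" "b \<in> D" "A = R #> a" "B = R #> b"
        unfolding FactGroup_def im[symmetric] by auto
      then show "A \<otimes>\<^bsub>G Mod R\<^esub> B = B \<otimes>\<^bsub>G Mod R\<^esub> A" using assms(8) by (simp add: R.rcos_sum)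
    qed
  qed
  then show ?thesis
  proof (rule derived2_trivial[OF _ R.subset])
    fix a b assume ab: "a \<in> R" "b \<in> R"
    interpret Rg: group "G\<lparr>carrier := R\<rparr>" by (rule subgroup_imp_group[OF R(1)])
    show "a \<otimes> b = b \<otimes> a" using Rg.prime_order_comm[of a b] ab R assms by (simp add: order_def)
  qed
qed

lemma (in group_hom) card_eq_card_kernel_mult_image:
  assumes "finite (carrier G)" "subgroup C G" "kernel G H h \<subseteq> C"
  shows "card C = card (kernel G H h) * card (h ` C)"
proof (rule card_eq_mult_card_image)
  interpret C: subgroup C G by fact
  show "finite C" using assms finite_subset[OF C.subset] by auto
  fix x assume x: "x \<in> C"
  have xc: "x \<in> carrier G" using x by auto
  have "bij_betw (\<lambda>z. x \<otimes> z) (kernel G H h) {y \<in> C. h y = h x}"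
  proof (rule bij_betwI[where g = "\<lambda>z. inv x \<otimes> z"])
    show "(\<lambda>z. x \<otimes> z) \<in> kernel G H h \<rightarrow> {y \<in> C. h y = h x}"
      using x xc assms(3) by (intro funcsetI) (auto simp: kernel_def)
    show "(\<lambda>z. inv x \<otimes> z) \<in> {y \<in> C. h y = h x} \<rightarrow> kernel G H h"
      using xc by (intro funcsetI) (auto simp: kernel_def)
    show "inv x \<otimes> (x \<otimes> z) = z" if "z \<in> kernel G H h" for z
      using that xc by (simp add: kernel_def G.m_assoc[symmetric])
    show "x \<otimes> (inv x \<otimes> z) = z" if "z \<in> {y \<in> C. h y = h x}" for z
      using that xc by (simp add: G.m_assoc[symmetric])
  qed
  then show "card {y \<in> C. h y = h x} = card (kernel G H h)" by (simp add: bij_betw_same_card)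
qed

lemma (in group_hom) derived2_subset_kernel:
  assumes "h ` carrier G = carrier H" "derived H (derived H (carrier H)) \<subseteq> {\<one>\<^bsub>H\<^esub>}"
  shows "derived G (derived G (carrier G)) \<subseteq> kernel G H h"
proof
  fix x assume x: "x \<in> derived G (derived G (carrier G))"
  have "h ` derived G (derived G (carrier G)) = derived H (derived H (h ` carrier G))"
    using derived_img[OF subset_refl] derived_img[OF G.derived_in_carrier[OF subset_refl]] by simp
  then have "h x = \<one>\<^bsub>H\<^esub>" using x assms by auto
  moreover have "x \<in> carrier G" using x G.derived_in_carrier[OF G.derived_in_carrier[OF subset_refl]] by auto
  ultimately show "x \<in> kernel G H h" by (simp add: kernel_def)
qed

text \<open>An element of \<open>C\<close> and gCg^-1 commutes with both groups, hence with all
  products in C gCg^-1. This set is the double coset CgC translated by g^-1, so it has the same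
  size.\<close>

lemma (in group) card_centralizer_inter_conj:
  assumes "finite (carrier G)" "x \<in> carrier G" "g \<in> carrier G" "m \<in> inter_conj (generate G {x}) g"
  shows "card (double_coset (generate G {x}) g) \<le> card {z \<in> carrier G. z \<otimes> m = m \<otimes> z}"
    and "\<And>a b. a \<in> generate G {x} \<Longrightarrow> b \<in> generate G {x} \<Longrightarrow> a \<otimes> (g \<otimes> b \<otimes> inv g) \<in> {z \<in> carrier G. z \<otimes> m = m \<otimes> z}"
    and "generate G {x} \<subseteq> {z \<in> carrier G. z \<otimes> m = m \<otimes> z}"
proof -
  let ?C = "generate G {x}" and ?Z = "{z \<in> carrier G. z \<otimes> m = m \<otimes> z}"
  interpret C: subgroup ?C G by (rule generate_singleton_subgroup[OF assms(2)])
  have m: "m \<in> ?C" "inv g \<otimes> m \<otimes> g \<in> ?C" using assms(4) by (auto simp: inter_conj_def)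
  have Z: "subgroup ?Z G" using m by (intro centralizer_subgroup) auto
  show CZ: "?C \<subseteq> ?Z" using generate_singleton_comm[OF assms(1,2) _ m(1)] C.subset by auto
  have gZ: "g \<otimes> b \<otimes> inv g \<in> ?Z" if b: "b \<in> ?C" for b
  proof -
    have e: "m = g \<otimes> (inv g \<otimes> m \<otimes> g) \<otimes> inv g" using conj_cancel(2)[of g m] m assms by auto
    have "b \<otimes> (inv g \<otimes> m \<otimes> g) = (inv g \<otimes> m \<otimes> g) \<otimes> b" by (rule generate_singleton_comm[OF assms(1,2) b m(2)])
    then have "g \<otimes> (b \<otimes> (inv g \<otimes> m \<otimes> g)) \<otimes> inv g = g \<otimes> ((inv g \<otimes> m \<otimes> g) \<otimes> b) \<otimes> inv g" by simp
    then have "(g \<otimes> b \<otimes> inv g) \<otimes> m = m \<otimes> (g \<otimes> b \<otimes> inv g)"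
      using conj_mult(1)[of g b "inv g \<otimes> m \<otimes> g"] conj_mult(1)[of g "inv g \<otimes> m \<otimes> g" b] e b m assms by auto
    then show ?thesis using b assms by auto
  qed
  show mem: "a \<otimes> (g \<otimes> b \<otimes> inv g) \<in> ?Z" if "a \<in> ?C" "b \<in> ?C" for a b
    using subgroup.m_closed[OF Z] CZ gZ[OF that(2)] that(1) by blast
  have "(\<lambda>z. z \<otimes> inv g) ` double_coset ?C g \<subseteq> ?Z"
  proof clarify
    fix z assume "z \<in> double_coset ?C g"
    then obtain a b where ab: "z = a \<otimes> g \<otimes> b" "a \<in> ?C" "b \<in> ?C" by (auto simp: double_coset_def)
    then have "z \<otimes> inv g = a \<otimes> (g \<otimes> b \<otimes> inv g)" using assms by (simp add: m_assoc)
    then show "z \<otimes> inv g \<in> carrier G \<and> z \<otimes> inv g \<otimes> m = m \<otimes> (z \<otimes> inv g)" using mem ab by auto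
  qed
  moreover have "inj_on (\<lambda>z. z \<otimes> inv g) (double_coset ?C g)"
    using assms by (intro inj_on_g) (auto simp: double_coset_def)
  ultimately show "card (double_coset ?C g) \<le> card ?Z"
    using card_inj_on_le[of "\<lambda>z. z \<otimes> inv g" "double_coset ?C g" ?Z] assms(1) by auto
qed

text \<open>The centralizer of an element of the intersection has order \<open>k * ord x\<close>
  with \<open>k\<close> dividing \<open>i\<close> and \<open>t <= k\<close>. The last hypothesis
  leaves only \<open>k = i\<close>; it holds for prime \<open>i\<close> with \<open>t > 1\<close>
  and for \<open>i = 4\<close>, \<open>t = 3\<close>.\<close>

lemma (in group) inter_conj_central:
  assumes "finite (carrier G)" "x \<in> carrier G" "g \<in> carrier G" "order G = i * ord x"
    and "card (double_coset (generate G {x}) g) = t * ord x" "\<And>k. k dvd i \<Longrightarrow> t \<le> k \<Longrightarrow> k = i"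
  shows "inter_conj (generate G {x}) g \<subseteq> group_center G"
proof
  let ?C = "generate G {x}"
  fix m assume m: "m \<in> inter_conj ?C g"
  let ?Z = "{z \<in> carrier G. z \<otimes> m = m \<otimes> z}"
  interpret C: subgroup ?C G by (rule generate_singleton_subgroup[OF assms(2)])
  have mc: "m \<in> carrier G" using m inter_conj_subset C.subset by blast
  have Z: "subgroup ?Z G" using mc by (rule centralizer_subgroup)
  note cz = card_centralizer_inter_conj[OF assms(1-3) m]
  have o: "ord x > 0" "card ?C = ord x" using ord_ge_1[OF assms(1,2)] generate_pow_card[OF assms(2)] by auto
  obtain k where k: "card ?Z = k * ord x" using card_subgroup_dvd[OF C.subgroup_axioms Z cz(3)] o by (metis dvdE mult.commute)
  have "k dvd i" using card_subgroup_dvd_order[OF Z] k o assms(4) by simp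
  moreover have "t \<le> k" using cz(1) k assms(5) o by simp
  ultimately have "card ?Z = order G" using assms k by simp
  then have "?Z = carrier G" using assms(1) by (intro card_subset_eq) (auto simp: order_def)
  then have "m \<otimes> g = g \<otimes> m" if "g \<in> carrier G" for g using that by (metis (mono_tags, lifting) mem_Collect_eq)
  then show "m \<in> group_center G" using mc by (auto simp: group_center_def)
qed

lemma (in group) central_normal:
  assumes "subgroup M G" "M \<subseteq> group_center G"
  shows "M \<lhd> G"
proof (rule normal_invI[OF assms(1)])
  fix g h assume g: "g \<in> carrier G" and h: "h \<in> M"
  then have "h \<otimes> g = g \<otimes> h" and hc: "h \<in> carrier G" using assms by (auto simp: group_center_def)
  then have "g \<otimes> h \<otimes> inv g = h \<otimes> g \<otimes> inv g" by simp
  then have "g \<otimes> h \<otimes> inv g = h" using g hc by (simp add: m_assoc)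
  then show "g \<otimes> h \<otimes> inv g \<in> M" using h by simp
qed

text \<open>If \<open>C\<close> is not normal, some \<open>g\<close> gives \<open>1 < t < p\<close>,
  and then the intersection \<open>M\<close> is central because \<open>p\<close> has no proper
  divisor that is at least \<open>t\<close>. In \<open>G/M\<close>, of order \<open>p t\<close>, the
  image of \<open>C\<close> is an abelian subgroup of order \<open>t\<close>.\<close>

lemma (in group) derived2_central_prime_index:
  assumes "finite (carrier G)" "x \<in> carrier G" "order G = p * ord x" "Factorial_Ring.prime p"
  shows "derived G (derived G (carrier G)) \<subseteq> group_center G"
proof -
  let ?C = "generate G {x}"
  interpret C: subgroup ?C G by (rule generate_singleton_subgroup[OF assms(2)])
  have o: "ord x > 0" "card ?C = ord x" using ord_ge_1[OF assms(1,2)] generate_pow_card[OF assms(2)] by auto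
  have xC: "x \<in> ?C" by (rule generate.incl) simp
  show ?thesis
  proof (cases "\<forall>g\<in>carrier G. inv g \<otimes> x \<otimes> g \<in> ?C")
    case True
    have "?C \<lhd> G" using True by (intro generate_singleton_normal[OF assms(1,2)]) (metis inv_closed inv_inv)
    moreover have "card (rcosets ?C) * ord x = p * ord x" using lagrange[OF C.subgroup_axioms] o assms by simp
    ultimately have "derived G (carrier G) \<subseteq> ?C" using assms o by (intro derived_subset_small_index) auto
    then have "derived G (derived G (carrier G)) \<subseteq> {\<one>}"
      by (rule derived2_trivial) (use C.subset generate_singleton_comm[OF assms(1,2)] in auto)
    then show ?thesis using one_in_center by blast
  next
    case False
    then obtain g where g: "g \<in> carrier G" "inv g \<otimes> x \<otimes> g \<notin> ?C" by auto
    then have gC: "g \<notin> ?C" using xC by auto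
    obtain t where t: "card ?C = t * card (inter_conj ?C g)" "t > 0" "t * card ?C + card ?C \<le> order G"
      "card (double_coset ?C g) = t * card ?C"
      using index_inter_conj[OF assms(1) C.subgroup_axioms g(1) gC] by metis
    have "(t + 1) * ord x \<le> p * ord x" using t(3) o assms by simp
    then have tp: "t < p" using o(1) unfolding mult_le_cancel2 by simp
    have t1: "t \<noteq> 1"
    proof
      assume "t = 1"
      then have "inter_conj ?C g = ?C" using t o by (intro card_subset_eq inter_conj_subset) (auto intro: card_ge_0_finite)
      then show False using g xC by (auto simp: inter_conj_def)
    qed
    let ?M = "inter_conj ?C g"
    have cen: "?M \<subseteq> group_center G"
    proof (rule inter_conj_central[OF assms(1,2) g(1) assms(3)])
      show "card (double_coset ?C g) = t * ord x" using t(4) o(2) by (simp only:)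
      fix k assume k: "k dvd p" "t \<le> k"
      then have "k \<noteq> 1" using t(2) t1 by linarith
      then show "k = p" using k(1) assms(4) unfolding prime_nat_iff by blast
    qed
    have Ms: "subgroup ?M G" by (rule inter_conj_subgroup[OF C.subgroup_axioms g(1)])
    have Mn: "?M \<lhd> G" by (rule central_normal[OF Ms cen])
    obtain H :: "nat monoid" and h where H: "group H" "group_hom G H h" "h ` carrier G = carrier H" "kernel G H h = ?M"
      "order G = order H * card ?M" "finite (carrier H)" using quotient_on_nat[OF assms(1) Mn] by blast
    interpret h: group_hom G H h by fact
    have tM: "ord x = t * card ?M" using t(1) o(2) by (simp only:)
    then have M0: "card ?M > 0" using o(1) by (metis gr_zeroI mult_0_right)
    have "order H * card ?M = p * t * card ?M" unfolding H(5)[symmetric] assms(3) tM by (simp only: mult.assoc)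
    then have oH: "order H = p * t" using M0 by simp
    have "card ?C = card ?M * card (h ` ?C)"
      using h.card_eq_card_kernel_mult_image[OF assms(1) C.subgroup_axioms] H(4) inter_conj_subset by auto
    then have "card ?M * card (h ` ?C) = card ?M * t" using tM o(2) by (simp only: mult.commute)
    then have cD: "card (h ` ?C) = t" using M0 by simp
    have "derived H (derived H (carrier H)) \<subseteq> {\<one>\<^bsub>H\<^esub>}"
    proof (rule h.H.derived2_trivial_of_prime_times_comm[OF H(6) assms(4) oH t(2) tp _ cD])
      show "subgroup (h ` ?C) H" by (rule h.subgroup_img_is_subgroup[OF C.subgroup_axioms])
      fix a b assume "a \<in> h ` ?C" "b \<in> h ` ?C"
      then obtain a' b' where ab: "a' \<in> ?C" "b' \<in> ?C" "a = h a'" "b = h b'" by auto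
      have "h (a' \<otimes> b') = h (b' \<otimes> a')" using generate_singleton_comm[OF assms(1,2) ab(1,2)] by simp
      then show "a \<otimes>\<^bsub>H\<^esub> b = b \<otimes>\<^bsub>H\<^esub> a" using ab by simp
    qed
    from h.derived2_subset_kernel[OF H(3) this] show ?thesis using H(4) cen by auto
  qed
qed

section \<open>Sharply two-transitive quotients\<close>

text \<open>For \<open>u = a g b\<close>, conjugation by \<open>a\<close> fixes the elements of the
  abelian group \<open>C\<close>, and conjugation by \<open>b\<close> maps \<open>C\<close> to
  itself, so neither affects the intersection.\<close>

lemma (in group) inter_conj_eq_of_double_coset:
  assumes "finite (carrier G)" "x \<in> carrier G" "g \<in> carrier G"
    and "u \<in> double_coset (generate G {x}) g"
  shows "inter_conj (generate G {x}) u = inter_conj (generate G {x}) g"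
proof -
  let ?C = "generate G {x}"
  interpret C: subgroup ?C G by (rule generate_singleton_subgroup[OF assms(2)])
  obtain a b where u: "u = a \<otimes> g \<otimes> b" "a \<in> ?C" "b \<in> ?C" using assms(4) by (auto simp: double_coset_def)
  have ab: "a \<in> carrier G" "b \<in> carrier G" using u by auto
  have "inv u \<otimes> c \<otimes> u \<in> ?C \<longleftrightarrow> inv g \<otimes> c \<otimes> g \<in> ?C" if c: "c \<in> ?C" for c
  proof -
    have cc: "c \<in> carrier G" using c by auto
    have "inv a \<otimes> c = c \<otimes> inv a" by (rule generate_singleton_comm[OF assms(1,2) _ c]) (use u in auto)
    then have "inv a \<otimes> c \<otimes> a = c \<otimes> inv a \<otimes> a" by simp
    then have 1: "inv a \<otimes> c \<otimes> a = c" using ab cc by (simp add: m_assoc)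
    have "inv u \<otimes> c \<otimes> u = inv b \<otimes> (inv g \<otimes> (inv a \<otimes> c \<otimes> a) \<otimes> g) \<otimes> b"
      using ab cc assms unfolding u(1) by (simp add: m_assoc inv_mult_group)
    then have e: "inv u \<otimes> c \<otimes> u = inv b \<otimes> (inv g \<otimes> c \<otimes> g) \<otimes> b" by (simp only: 1)
    show ?thesis
    proof
      assume "inv u \<otimes> c \<otimes> u \<in> ?C"
      then have "b \<otimes> (inv b \<otimes> (inv g \<otimes> c \<otimes> g) \<otimes> b) \<otimes> inv b \<in> ?C" using u unfolding e by auto
      then show "inv g \<otimes> c \<otimes> g \<in> ?C" using conj_cancel(2)[OF ab(2), of "inv g \<otimes> c \<otimes> g"] cc assms by simp
    next
      assume "inv g \<otimes> c \<otimes> g \<in> ?C"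
      then show "inv u \<otimes> c \<otimes> u \<in> ?C" unfolding e using u by auto
    qed
  qed
  then show ?thesis by (auto simp: inter_conj_def)
qed

text \<open>All \<open>u\<close> outside \<open>C\<close> lie in one double coset and give the same
  intersection \<open>M\<close>. So \<open>M\<close> is the kernel of the action on the cosets of
  \<open>C\<close>. Modulo \<open>M\<close> the action is sharply two-transitive on
  \<open>t + 1\<close> points, with point stabilizer \<open>D\<close>.\<close>

lemma (in group) quotient_of_two_transitive:
  assumes "finite (carrier G)" "x \<in> carrier G" "g \<in> carrier G" "order G = Suc t * ord x"
    and t: "ord x = t * card (inter_conj (generate G {x}) g)"
    and dc: "carrier G - generate G {x} \<subseteq> double_coset (generate G {x}) g"
  obtains H :: "nat monoid" and h D where "group_hom G H h" "h ` carrier G = carrier H"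
    "kernel G H h = inter_conj (generate G {x}) g" "finite (carrier H)" "order H = Suc t * t"
    "subgroup D H" "card D = t" "\<And>w. w \<in> carrier H \<Longrightarrow> w \<notin> D \<Longrightarrow> group.inter_conj H D w \<subseteq> {\<one>\<^bsub>H\<^esub>}"
proof -
  let ?C = "generate G {x}" let ?M = "inter_conj ?C g"
  interpret C: subgroup ?C G by (rule generate_singleton_subgroup[OF assms(2)])
  have o: "ord x > 0" "card ?C = ord x" using ord_ge_1[OF assms(1,2)] generate_pow_card[OF assms(2)] by auto
  have Ms: "subgroup ?M G" by (rule inter_conj_subgroup[OF C.subgroup_axioms assms(3)])
  have M: "inter_conj ?C u = ?M" if "u \<in> carrier G" "u \<notin> ?C" for u
    using inter_conj_eq_of_double_coset[OF assms(1-3)] dc that by blast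
  have Mn: "?M \<lhd> G"
  proof (rule normal_invI[OF Ms])
    fix u m assume u: "u \<in> carrier G" and m: "m \<in> ?M"
    have mC: "m \<in> ?C" using m inter_conj_subset by blast
    have mc: "m \<in> carrier G" using mC by auto
    show "u \<otimes> m \<otimes> inv u \<in> ?M"
    proof (cases "u \<in> ?C")
      case True
      have "u \<otimes> m \<otimes> inv u = m \<otimes> u \<otimes> inv u" using generate_singleton_comm[OF assms(1,2) True mC] by simp
      then show ?thesis using m mc u by (simp add: m_assoc)
    next
      case False
      then have iu: "inv u \<notin> ?C" using u by (metis C.m_inv_closed inv_inv)
      have "m \<in> inter_conj ?C (inv u)" using M[OF _ iu] u m by simp
      then have "u \<otimes> m \<otimes> inv u \<in> ?C" using u by (simp add: inter_conj_def)
      moreover have "inv u \<otimes> (u \<otimes> m \<otimes> inv u) \<otimes> u \<in> ?C" using conj_cancel(1)[OF u mc] mC by simp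
      ultimately have "u \<otimes> m \<otimes> inv u \<in> inter_conj ?C u" by (simp add: inter_conj_def)
      then show ?thesis using M[OF u False] by simp
    qed
  qed
  obtain H :: "nat monoid" and h where H: "group H" "group_hom G H h" "h ` carrier G = carrier H" "kernel G H h = ?M"
    "order G = order H * card ?M" "finite (carrier H)" using quotient_on_nat[OF assms(1) Mn] by blast
  interpret h: group_hom G H h by fact
  have M0: "card ?M > 0" using o(1) t by (metis gr_zeroI mult_0_right)
  have "order H * card ?M = Suc t * t * card ?M" unfolding H(5)[symmetric] assms(4) t by (simp only: mult.assoc)
  then have oH: "order H = Suc t * t" using M0 by (metis mult_cancel2 less_numeral_extra(3))
  have ker: "kernel G H h \<subseteq> ?C" using H(4) inter_conj_subset by auto
  have "card ?M * card (h ` ?C) = card ?M * t"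
    using h.card_eq_card_kernel_mult_image[OF assms(1) C.subgroup_axioms ker] H(4) t o(2) by (simp only: mult.commute)
  then have cD: "card (h ` ?C) = t" using M0 by simp
  \<comment> \<open>As the kernel lies in \<open>C\<close>, membership in \<open>C\<close> can be
    tested on images; this pulls a relation in the quotient back to \<open>G\<close>.\<close>
  have sat: "z \<in> ?C" if z: "z \<in> carrier G" "h z \<in> h ` ?C" for z
  proof -
    obtain c where c: "c \<in> ?C" "h z = h c" using z by auto
    have "z \<otimes> inv c \<in> kernel G H h" using c z by (simp add: kernel_def)
    then have "(z \<otimes> inv c) \<otimes> c \<in> ?C" using ker c by blast
    then show ?thesis using c z by (simp add: m_assoc)
  qed
  have tr: "group.inter_conj H (h ` ?C) w \<subseteq> {\<one>\<^bsub>H\<^esub>}" if w: "w \<in> carrier H" "w \<notin> h ` ?C" for w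
  proof
    fix d assume "d \<in> group.inter_conj H (h ` ?C) w"
    then have d: "d \<in> h ` ?C" "inv\<^bsub>H\<^esub> w \<otimes>\<^bsub>H\<^esub> d \<otimes>\<^bsub>H\<^esub> w \<in> h ` ?C" by (auto simp: h.H.inter_conj_def)
    obtain u where u: "u \<in> carrier G" "w = h u" using w(1) H(3) by (metis imageE)
    obtain c where c: "c \<in> ?C" "d = h c" using d(1) by auto
    have cc: "c \<in> carrier G" using c by auto
    have uC: "u \<notin> ?C" using w(2) u by auto
    have "h (inv u \<otimes> c \<otimes> u) \<in> h ` ?C" using d(2) u cc c by simp
    then have "inv u \<otimes> c \<otimes> u \<in> ?C" using u cc by (intro sat) auto
    then have "c \<in> inter_conj ?C u" using c by (simp add: inter_conj_def)
    then have "c \<in> kernel G H h" using M[OF u(1) uC] H(4) by simp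
    then show "d \<in> {\<one>\<^bsub>H\<^esub>}" using c by (simp add: kernel_def)
  qed
  show thesis
    by (rule that[OF H(2,3,4,6) oH h.subgroup_img_is_subgroup[OF C.subgroup_axioms] cD tr])
qed

lemma card_le_mult_card_image:
  assumes "finite A" "\<And>x. x \<in> A \<Longrightarrow> card {y \<in> A. f y = f x} \<le> k"
  shows "card A \<le> k * card (f ` A)"
proof -
  have "card A = (\<Sum>z\<in>f ` A. card {y \<in> A. f y = z})"
    using sum.image_gen[OF assms(1), of "\<lambda>_. 1::nat" f] by simp
  also have "\<dots> \<le> (\<Sum>z\<in>f ` A. k)" using assms(2) by (intro sum_mono) auto
  finally show ?thesis by (simp add: mult.commute)
qed

section \<open>Frobenius kernels by counting\<close>

context group begin

text \<open>The identity together with the elements that fix no coset of \<open>D\<close>. It is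
  introduced as a mere set; the counts below replace Frobenius' theorem that it is a
  subgroup.\<close>

definition frobenius_kernel :: "'a set \<Rightarrow> 'a set" where
  "frobenius_kernel D = {e \<in> carrier G. \<forall>w\<in>carrier G. inv w \<otimes> e \<otimes> w \<in> D \<longrightarrow> e = \<one>}"

text \<open>If \<open>w d w^-1 = w0 d0 w0^-1\<close> with \<open>d0\<close> nontrivial, then
  \<open>d0\<close> lies in \<open>D\<close> and in its conjugate by \<open>v = w0^-1 w\<close>,
  which forces \<open>v\<close> into \<open>D\<close>. So \<open>(w, d) -> w d w^-1\<close> has
  fibres of size at most \<open>t\<close>, the conjugates of nontrivial elements of \<open>D\<close>
  number at least \<open>(t+1)(t-1)\<close>, and at most \<open>t + 1\<close> of the
  \<open>t(t+1)\<close> elements remain.\<close>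

lemma card_frobenius_kernel:
  assumes "finite (carrier G)" "order G = Suc t * t" "2 \<le> t" "subgroup D G" "card D = t"
    and triv: "\<And>w. w \<in> carrier G \<Longrightarrow> w \<notin> D \<Longrightarrow> inter_conj D w \<subseteq> {\<one>}"
  shows "card (frobenius_kernel D) \<le> Suc t"
proof -
  interpret D: subgroup D G by fact
  have fD: "finite D" using assms finite_subset[OF D.subset] by auto
  let ?A = "carrier G \<times> (D - {\<one>})" and ?f = "\<lambda>(w,d). w \<otimes> d \<otimes> inv w"
  have "card ?A \<le> t * card (?f ` ?A)"
  proof (rule card_le_mult_card_image)
    show "finite ?A" using assms fD by auto
    fix z assume "z \<in> ?A"
    then obtain w0 d0 where z: "z = (w0,d0)" "w0 \<in> carrier G" "d0 \<in> D" "d0 \<noteq> \<one>" by auto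
    have d0c: "d0 \<in> carrier G" using z by auto
    let ?F = "{y \<in> ?A. ?f y = ?f z}"
    have F: "inv w0 \<otimes> w \<in> D" "d = inv (inv w0 \<otimes> w) \<otimes> d0 \<otimes> (inv w0 \<otimes> w)" if wd: "(w,d) \<in> ?F" for w d
    proof -
      have c: "w \<in> carrier G" "d \<in> D" "d \<in> carrier G" and e: "w \<otimes> d \<otimes> inv w = w0 \<otimes> d0 \<otimes> inv w0" using wd z by auto
      define v where "v = inv w0 \<otimes> w"
      have vc: "v \<in> carrier G" using c z by (simp add: v_def)
      have "inv v \<otimes> d0 \<otimes> v = inv w \<otimes> (w0 \<otimes> d0 \<otimes> inv w0) \<otimes> w"
        using c z d0c unfolding v_def by (simp add: m_assoc inv_mult_group)
      also have "\<dots> = d" unfolding e[symmetric] using conj_cancel(1)[of w d] c by simp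
      finally have dd: "inv v \<otimes> d0 \<otimes> v = d" .
      then show "d = inv (inv w0 \<otimes> w) \<otimes> d0 \<otimes> (inv w0 \<otimes> w)" by (simp add: v_def)
      have "d0 \<in> inter_conj D v" using dd c z by (simp add: inter_conj_def)
      then have "v \<in> D" using triv[OF vc] z(4) by blast
      then show "inv w0 \<otimes> w \<in> D" by (simp add: v_def)
    qed
    have "inj_on (\<lambda>(w,d). inv w0 \<otimes> w) ?F"
    proof (rule inj_onI)
      fix p q assume p: "p \<in> ?F" and q: "q \<in> ?F" and e: "(case p of (w,d) \<Rightarrow> inv w0 \<otimes> w) = (case q of (w,d) \<Rightarrow> inv w0 \<otimes> w)"
      obtain w d w' d' where pq: "p = (w,d)" "q = (w',d')" by (metis surj_pair)
      have "w = w'" using e p q z unfolding pq by simp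
      moreover have "d = d'" using F(2)[of w d] F(2)[of w' d'] p q \<open>w = w'\<close> unfolding pq by metis
      ultimately show "p = q" by (simp add: pq)
    qed
    moreover have "(\<lambda>(w,d). inv w0 \<otimes> w) ` ?F \<subseteq> D"
    proof (rule image_subsetI)
      fix q assume q: "q \<in> ?F"
      obtain w d where "q = (w,d)" by (metis surj_pair)
      then show "(case q of (w,d) \<Rightarrow> inv w0 \<otimes> w) \<in> D" using F(1)[of w d] q by simp
    qed
    ultimately show "card ?F \<le> t" using card_inj_on_le[OF _ _ fD] assms(5) by blast
  qed
  moreover have "card ?A = Suc t * t * (t - 1)"
    using assms(2,5) fD by (simp add: card_cartesian_product order_def card_Diff_singleton[OF D.one_closed])
  moreover have "Suc t * t * (t - 1) = t * (Suc t * (t - 1))" by (simp only: mult.assoc mult.left_commute)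
  ultimately have "t * (Suc t * (t - 1)) \<le> t * card (?f ` ?A)" by (simp only:)
  then have 1: "Suc t * (t - 1) \<le> card (?f ` ?A)" using assms(3) unfolding mult_le_cancel1 by linarith
  have sub: "?f ` ?A \<subseteq> carrier G" by auto
  have "frobenius_kernel D \<subseteq> carrier G - ?f ` ?A"
  proof
    fix e assume e: "e \<in> frobenius_kernel D"
    have "e \<notin> ?f ` ?A"
    proof
      assume "e \<in> ?f ` ?A"
      then obtain w d where wd: "e = w \<otimes> d \<otimes> inv w" "w \<in> carrier G" "d \<in> D" "d \<noteq> \<one>" by auto
      have dc: "d \<in> carrier G" using wd by auto
      have ed: "inv w \<otimes> e \<otimes> w = d" unfolding wd(1) using conj_cancel(1)[of w d] wd dc by simp
      then have "inv w \<otimes> e \<otimes> w \<in> D" using wd(3) by simp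
      then have "e = \<one>" using e wd(2) unfolding frobenius_kernel_def by blast
      then have "d = \<one>" using ed wd(2) by simp
      then show False using wd by simp
    qed
    then show "e \<in> carrier G - ?f ` ?A" using e by (auto simp: frobenius_kernel_def)
  qed
  then have "card (frobenius_kernel D) \<le> card (carrier G - ?f ` ?A)" using assms(1) by (intro card_mono) auto
  also have "\<dots> = Suc t * t - card (?f ` ?A)" using card_Diff_subset[OF finite_subset[OF sub assms(1)] sub] assms(2) by (simp add: order_def)
  also have "\<dots> \<le> Suc t * t - Suc t * (t - 1)" using 1 by linarith
  also have "\<dots> = Suc t" using assms(3) by (cases t) auto
  finally show ?thesis .
qed

lemma frobenius_kernel_of_coprime_order:
  assumes "finite (carrier G)" "subgroup D G" "e \<in> carrier G" "coprime (ord e) (card D)"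
  shows "e \<in> frobenius_kernel D"
  unfolding frobenius_kernel_def
proof (intro CollectI conjI ballI impI)
  show "e \<in> carrier G" by fact
  fix w assume w: "w \<in> carrier G" and d: "inv w \<otimes> e \<otimes> w \<in> D"
  define z where "z = inv w \<otimes> e \<otimes> w"
  have zc: "z \<in> carrier G" using w assms by (simp add: z_def)
  have "z [^] ord e = inv w \<otimes> e [^] ord e \<otimes> w" using conj_pow[of "inv w" e "ord e"] w assms unfolding z_def by (simp del: pow_ord_eq_1)
  then have 1: "ord z dvd ord e" using w assms zc by (simp add: pow_eq_id[symmetric])
  have sub: "generate G {z} \<subseteq> D" by (rule generate_subgroup_incl[OF _ assms(2)]) (use d in \<open>auto simp: z_def\<close>)
  have "ord z dvd card D"
    using card_subgroup_dvd[OF generate_singleton_subgroup[OF zc] assms(2) sub] generate_pow_card[OF zc] by simp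
  then have "ord z = 1" using 1 assms(4) by (metis coprime_common_divisor_nat)
  then have "z = \<one>" using ord_eq_1[OF zc] by simp
  moreover have "w \<otimes> z \<otimes> inv w = e" unfolding z_def using conj_cancel(2)[OF w assms(3)] .
  ultimately show "e = \<one>" using w by simp
qed

lemma exists_elem_of_prime_order:
  assumes "finite (carrier G)" "Factorial_Ring.prime p" "order G = p * m"
  obtains a where "a \<in> carrier G" "ord a = p"
proof -
  obtain R where R: "subgroup R G" "card R = p" using sylow_thm[OF assms(2) is_group, of 1 m] assms by auto
  interpret R: subgroup R G by fact
  have "R \<noteq> {\<one>}" using R(2) prime_gt_1_nat[OF assms(2)] by auto
  then obtain a where a: "a \<in> R" "a \<noteq> \<one>" using R.one_closed by blast
  have ac: "a \<in> carrier G" using a by auto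
  have sub: "generate G {a} \<subseteq> R" by (rule generate_subgroup_incl[OF _ R(1)]) (use a in auto)
  have "ord a dvd p" using card_subgroup_dvd[OF generate_singleton_subgroup[OF ac] R(1) sub] generate_pow_card[OF ac] R by simp
  moreover have "ord a \<noteq> 1" using ord_eq_1[OF ac] a by simp
  ultimately have "ord a = p" using assms(2) unfolding prime_nat_iff by blast
  then show thesis using that ac by blast
qed

text \<open>A Sylow 2-subgroup has four elements of order coprime to 3, so it fills the Frobenius
  kernel. That set is invariant under conjugation, hence the Sylow subgroup is normal; it and the
  quotient, of orders 4 and 3, are abelian.\<close>

lemma derived2_trivial_of_two_transitive_4:
  assumes "finite (carrier G)" "order G = 12" "subgroup D G" "card D = 3"
    and "\<And>w. w \<in> carrier G \<Longrightarrow> w \<notin> D \<Longrightarrow> inter_conj D w \<subseteq> {\<one>}"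
  shows "derived G (derived G (carrier G)) \<subseteq> {\<one>}"
proof -
  have c: "card (frobenius_kernel D) \<le> 4" using card_frobenius_kernel[OF assms(1) _ _ assms(3,4)] assms(2,5) by simp
  have "\<exists>S. subgroup S G \<and> card S = 2 ^ 2" using sylow_thm[OF two_is_prime_nat is_group, of 2 3] assms by auto
  then obtain S where S: "subgroup S G" "card S = 4" by auto
  interpret S: subgroup S G by fact
  have "S \<subseteq> frobenius_kernel D"
  proof
    fix e assume e: "e \<in> S"
    then have ec: "e \<in> carrier G" by auto
    have sub: "generate G {e} \<subseteq> S" by (rule generate_subgroup_incl[OF _ S(1)]) (use e in auto)
    have od: "ord e dvd 4" using card_subgroup_dvd[OF generate_singleton_subgroup[OF ec] S(1) sub] generate_pow_card[OF ec] S by simp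
    have "coprime (4::nat) 3" by (simp add: coprime_iff_gcd_eq_1 gcd_non_0_nat)
    then have "coprime (ord e) (card D)" unfolding assms(4) using coprime_divisors[OF od dvd_refl] by blast
    then show "e \<in> frobenius_kernel D" by (rule frobenius_kernel_of_coprime_order[OF assms(1,3) ec])
  qed
  then have SE: "S = frobenius_kernel D" using c S assms(1) by (intro card_seteq) (auto simp: frobenius_kernel_def)
  have Sn: "S \<lhd> G"
  proof (rule normal_invI[OF S(1)])
    fix g s assume g: "g \<in> carrier G" and s: "s \<in> S"
    have sc: "s \<in> carrier G" using s by auto
    have "g \<otimes> s \<otimes> inv g \<in> frobenius_kernel D" unfolding frobenius_kernel_def
    proof (intro CollectI conjI ballI impI)
      show "g \<otimes> s \<otimes> inv g \<in> carrier G" using g sc by simp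
      fix w assume w: "w \<in> carrier G" and d: "inv w \<otimes> (g \<otimes> s \<otimes> inv g) \<otimes> w \<in> D"
      have "inv w \<otimes> (g \<otimes> s \<otimes> inv g) \<otimes> w = inv (inv g \<otimes> w) \<otimes> s \<otimes> (inv g \<otimes> w)"
        using w g sc by (simp add: m_assoc inv_mult_group)
      then have "s = \<one>" using s d w g unfolding SE frobenius_kernel_def by auto
      then show "g \<otimes> s \<otimes> inv g = \<one>" using g by simp
    qed
    then show "g \<otimes> s \<otimes> inv g \<in> S" by (simp add: SE)
  qed
  have "card (rcosets S) = 3" using lagrange[OF S(1)] S assms by simp
  then have "derived G (carrier G) \<subseteq> S" using assms(1) Sn by (intro derived_subset_small_index) auto
  then show ?thesis
  proof (rule derived2_trivial[OF _ S.subset])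
    fix a b assume ab: "a \<in> S" "b \<in> S"
    interpret Sg: group "G\<lparr>carrier := S\<rparr>" by (rule subgroup_imp_group[OF S(1)])
    have "finite S" using S by (intro card_ge_0_finite) simp
    then show "a \<otimes> b = b \<otimes> a" using Sg.order_le_4_comm[of a b] ab S by (simp add: order_def)
  qed
qed

text \<open>\<open>D\<close> acts transitively on the nontrivial elements of the Frobenius kernel, so they all have the same
  order, although both 2 and 3 occur.\<close>
lemma no_two_transitive_6:
  assumes "finite (carrier G)" "order G = 30" "subgroup D G" "card D = 5"
    and triv: "\<And>w. w \<in> carrier G \<Longrightarrow> w \<notin> D \<Longrightarrow> inter_conj D w \<subseteq> {\<one>}"
  shows False
proof -
  interpret D: subgroup D G by fact
  have c: "card (frobenius_kernel D) \<le> 6" using card_frobenius_kernel[OF assms(1) _ _ assms(3,4)] assms(2,5) by simp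
  have p3: "Factorial_Ring.prime (3::nat)" by simp
  obtain a where a: "a \<in> carrier G" "ord a = 3" using exists_elem_of_prime_order[OF assms(1) p3, of 10] assms(2) by auto
  obtain b where b: "b \<in> carrier G" "ord b = 2" using exists_elem_of_prime_order[OF assms(1) two_is_prime_nat, of 15] assms(2) by auto
  have cop: "coprime (3::nat) 5" "coprime (2::nat) 5" by (auto simp: coprime_iff_gcd_eq_1 gcd_non_0_nat)
  have aE: "a \<in> frobenius_kernel D" using a assms cop by (intro frobenius_kernel_of_coprime_order) auto
  have bE: "b \<in> frobenius_kernel D" using b assms cop by (intro frobenius_kernel_of_coprime_order) auto
  have a1: "a \<noteq> \<one>" "b \<noteq> \<one>" using a b by auto
  have aD: "a \<notin> D" using aE a1 a by (auto simp: frobenius_kernel_def dest!: bspec[of _ _ \<one>])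
  have fE: "finite (frobenius_kernel D)" using assms(1) by (auto simp: frobenius_kernel_def)
  have oneE: "\<one> \<in> frobenius_kernel D" by (auto simp: frobenius_kernel_def)
  let ?f = "\<lambda>d. d \<otimes> a \<otimes> inv d"
  \<comment> \<open>If \<open>d\<close> and \<open>d'\<close> conjugate \<open>a\<close> to the same
    element, then \<open>d'^-1 d\<close> commutes with \<open>a\<close> and so lies in
    \<open>D\<close> and its conjugate by \<open>a\<close>, which meet trivially. The five distinct
    conjugates of \<open>a\<close> then exhaust the nontrivial part of the kernel, including
    \<open>b\<close>.\<close>
  have inj: "inj_on ?f D"
  proof (rule inj_onI)
    fix d d' assume d: "d \<in> D" "d' \<in> D" and e: "d \<otimes> a \<otimes> inv d = d' \<otimes> a \<otimes> inv d'"
    have dc: "d \<in> carrier G" "d' \<in> carrier G" using d by auto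
    define v where "v = inv d' \<otimes> d"
    have v: "v \<in> D" "v \<in> carrier G" using d by (auto simp: v_def)
    have "v \<otimes> a \<otimes> inv v = inv d' \<otimes> (d \<otimes> a \<otimes> inv d) \<otimes> d'" using dc a unfolding v_def by (simp add: m_assoc inv_mult_group)
    also have "\<dots> = a" unfolding e using conj_cancel(1)[of d' a] dc a by simp
    finally have "v \<otimes> a = a \<otimes> v" using v a by (simp add: inv_solve_right')
    then have "inv a \<otimes> v \<otimes> a = inv a \<otimes> (a \<otimes> v)" using v a by (simp add: m_assoc)
    then have "inv a \<otimes> v \<otimes> a = v" using v a by (simp add: m_assoc[symmetric])
    then have "v \<in> inter_conj D a" using v by (simp add: inter_conj_def)
    then have "v = \<one>" using triv[OF a(1) aD] by blast
    then show "d = d'" using dc unfolding v_def by (simp add: inv_solve_left')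
  qed
  have im: "?f ` D \<subseteq> frobenius_kernel D - {\<one>}"
  proof clarify
    fix d assume d: "d \<in> D"
    have dc: "d \<in> carrier G" using d by auto
    have o: "(d \<otimes> a \<otimes> inv d) [^] (3::nat) = \<one>" using conj_pow[OF dc a(1), of 3] pow_ord_eq_1[OF a(1)] a dc by simp
    then have od: "ord (d \<otimes> a \<otimes> inv d) dvd 3" using dc a by (simp add: pow_eq_id)
    have "coprime (ord (d \<otimes> a \<otimes> inv d)) (card D)" unfolding assms(4) by (rule coprime_divisors[OF od dvd_refl cop(1)])
    then have "d \<otimes> a \<otimes> inv d \<in> frobenius_kernel D"
      using dc a by (intro frobenius_kernel_of_coprime_order[OF assms(1,3)]) auto
    moreover have "d \<otimes> a \<otimes> inv d \<noteq> \<one>"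
      using conj_cancel(1)[OF dc a(1)] a1 dc by (metis inv_closed l_inv r_one)
    ultimately show "d \<otimes> a \<otimes> inv d \<in> frobenius_kernel D - {\<one>}" by simp
  qed
  have "card (frobenius_kernel D - {\<one>}) \<le> 5" using c oneE fE by (simp add: card_Diff_singleton)
  then have "?f ` D = frobenius_kernel D - {\<one>}" 
    by (intro card_seteq[OF _ im]) (simp_all add: card_image[OF inj] fE assms(4))
  then obtain d where d: "d \<in> D" "b = d \<otimes> a \<otimes> inv d" using bE a1 by blast
  have dc: "d \<in> carrier G" using d by auto
  have "b [^] (3::nat) = \<one>" unfolding d(2) using conj_pow[OF dc a(1), of 3] pow_ord_eq_1[OF a(1)] a dc by simp
  then have "(2::nat) dvd 3" using b by (simp add: pow_eq_id)
  then show False by simp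
qed

end

section \<open>Cyclic subgroups of index four\<close>

text \<open>For \<open>z = x [^] k\<close>, the order of \<open>x\<close> divides \<open>2k\<close>
  but not \<open>k\<close>, so \<open>2k\<close> is an odd multiple of it. The explicit value makes
  any two involutions of the cyclic group equal at once.\<close>

lemma (in group) cyclic_involution_unique:
  assumes "finite (carrier G)" "x \<in> carrier G" "z \<in> generate G {x}" "z \<noteq> \<one>" "z \<otimes> z = \<one>"
  shows "z = x [^] (ord x div 2)"
proof -
  obtain k :: nat where k: "z = x [^] k" using assms mem_generate_singleton by auto
  have "x [^] (k + k) = \<one>" using assms(5) unfolding k by (simp add: nat_pow_mult assms(2))
  then have "ord x dvd 2 * k" using assms(2) by (simp add: pow_eq_id mult_2)
  then obtain j where j: "2 * k = ord x * j" by (metis dvdE)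
  have nd: "\<not> ord x dvd k" using assms(2,4) k pow_eq_id by auto
  have "odd j"
  proof
    assume "even j"
    then obtain j' where "j = 2 * j'" by (metis evenE)
    then have "k = ord x * j'" using j by simp
    then show False using nd by simp
  qed
  then obtain j' where j': "j = 2 * j' + 1" by (metis oddE)
  then have "even (ord x)" using j \<open>odd j\<close> by (metis dvd_triv_left even_mult_iff)
  then obtain r where r: "ord x = 2 * r" by (metis evenE)
  then have "k = r + ord x * j'" using j j' by (simp add: algebra_simps)
  then have "z = x [^] r \<otimes> (x [^] ord x) [^] j'" unfolding k using assms(2) by (simp add: nat_pow_mult nat_pow_pow del: pow_ord_eq_1)
  moreover have "ord x div 2 = r" using r by simp
  ultimately show ?thesis using assms(2) by simp
qed

text \<open>Squares of elements of \<open>N\<close> lie in \<open>M = C \<inter> gCg\<^sup>-\<^sup>1\<close>, which is central in \<open>N\<close> and contains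
  the derived subgroup of \<open>N\<close>. Hence commutators in \<open>N\<close> square to 1, and the cyclic group \<open>M\<close>
  has at most one involution.\<close>
lemma (in group) derived2_central_normalizer_index_2:
  assumes "finite (carrier G)" "x \<in> carrier G" "subgroup N G" "order G = 2 * card N" "card N = 2 * ord x"
    and "g \<in> carrier G" "card (double_coset (generate G {x}) g) = 2 * ord x"
    and CN: "generate G {x} \<subseteq> N" and nC: "\<And>w c. w \<in> N \<Longrightarrow> c \<in> generate G {x} \<Longrightarrow> w \<otimes> c \<otimes> inv w \<in> generate G {x}"
  shows "derived G (derived G (carrier G)) \<subseteq> group_center G"
proof -
  let ?C = "generate G {x}" let ?M = "inter_conj ?C g"
  interpret C: subgroup ?C G by (rule generate_singleton_subgroup[OF assms(2)])
  interpret N: subgroup N G by fact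
  have fN: "finite N" using assms(1) finite_subset[OF N.subset] by auto
  have o: "ord x > 0" "card ?C = ord x" using ord_ge_1[OF assms(1,2)] generate_pow_card[OF assms(2)] by auto
  have Nn: "N \<lhd> G"
  proof (rule normal_invI[OF assms(3)])
    fix u v assume u: "u \<in> carrier G" and v: "v \<in> N"
    show "u \<otimes> v \<otimes> inv u \<in> N"
    proof (cases "u \<in> N")
      case False
      \<comment> \<open>Index two leaves room only for \<open>t = 1\<close>, so \<open>N\<close>
        coincides with each of its conjugates.\<close>
      obtain t where t: "card N = t * card (inter_conj N (inv u))" "t > 0" "t * card N + card N \<le> order G"
        using index_inter_conj[OF assms(1,3), of "inv u"] u False by (metis N.m_inv_closed inv_closed inv_inv)
      have "0 < card N" using assms(5) o by simp
      moreover have "(t + 1) * card N \<le> 2 * card N" using t(3) assms(4) by simp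
      ultimately have "t = 1" using t(2) unfolding mult_le_cancel2 by linarith
      then have "card N = card (inter_conj N (inv u))" using t(1) by simp
      then have "inter_conj N (inv u) = N" using fN by (intro card_subset_eq inter_conj_subset) auto
      then have "v \<in> inter_conj N (inv u)" using v by simp
      then show ?thesis using u by (simp add: inter_conj_def)
    qed (use v in auto)
  qed
  interpret Nn: normal N G by fact
  have cr: "card (rcosets N) = 2" using lagrange[OF assms(3)] assms(4,5) o by simp
  have GN: "derived G (carrier G) \<subseteq> N" using cr by (intro derived_subset_small_index[OF assms(1) Nn]) simp
  let ?N = "G\<lparr>carrier := N\<rparr>"
  interpret Ng: group ?N by (rule subgroup_imp_group[OF assms(3)])
  have Cn: "?C \<lhd> ?N"
  proof (rule Ng.normal_invI)
    show "subgroup ?C ?N" by (rule subgroup_incl[OF C.subgroup_axioms assms(3) CN])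
    show "u \<otimes>\<^bsub>?N\<^esub> c \<otimes>\<^bsub>?N\<^esub> inv\<^bsub>?N\<^esub> u \<in> ?C" if "u \<in> carrier ?N" "c \<in> ?C" for u c
      using nC that by (simp add: m_inv_consistent[OF assms(3)])
  qed
  have "card (rcosets\<^bsub>?N\<^esub> ?C) * ord x = 2 * ord x" using Ng.lagrange[OF normal_imp_subgroup[OF Cn]] o assms(5) by (simp add: order_def)
  then have cC: "card (rcosets\<^bsub>?N\<^esub> ?C) = 2" using o by simp
  have "derived ?N (carrier ?N) \<subseteq> ?C" using cC fN by (intro Ng.derived_subset_small_index[OF _ Cn]) auto
  then have DC: "derived G N \<subseteq> ?C" using derived_consistent[OF subset_refl assms(3)] by simp
  have sqC: "v \<otimes> v \<in> ?C" if "v \<in> N" for v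
    using Ng.pow_index_mem[OF Cn, of v] that cC by (simp add: numeral_2_eq_2)
  interpret D: normal "derived G N" G by (rule derived_is_normal[OF Nn])
  \<comment> \<open>The derived subgroup of \<open>N\<close> lies in \<open>C\<close> and is normal
    in \<open>G\<close>, so it also lies in gCg^-1.\<close>
  have DM: "z \<in> ?M" if z: "z \<in> derived G N" for z
    using DC z D.inv_op_closed1[OF assms(6) z] by (auto simp: inter_conj_def)
  have sqM: "v \<otimes> v \<in> ?M" if v: "v \<in> N" for v
  proof -
    have vc: "v \<in> carrier G" using v by auto
    have "(inv g \<otimes> v \<otimes> g) \<otimes> (inv g \<otimes> v \<otimes> g) \<in> ?C" using Nn.inv_op_closed1[OF assms(6) v] by (rule sqC)
    then show ?thesis using sqC[OF v] conj_mult(2)[OF assms(6) vc vc] by (simp add: inter_conj_def)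
  qed
  \<comment> \<open>The set C gCg^-1 lies in \<open>N\<close>, centralizes \<open>m\<close>, and has
    as many elements as CgC, namely \<open>2 * ord x = card N\<close>. So it is all of
    \<open>N\<close>.\<close>
  have MN: "v \<otimes> m = m \<otimes> v" if m: "m \<in> ?M" and v: "v \<in> N" for m v
  proof -
    let ?Z = "{z \<in> carrier G. z \<otimes> m = m \<otimes> z}"
    have mc: "m \<in> carrier G" using m inter_conj_subset C.subset by blast
    have Z: "subgroup ?Z G" using mc by (rule centralizer_subgroup)
    have "(\<lambda>z. z \<otimes> inv g) ` double_coset ?C g \<subseteq> ?Z \<inter> N"
    proof (rule image_subsetI)
      fix z assume "z \<in> double_coset ?C g"
      then obtain a b where ab: "z = a \<otimes> g \<otimes> b" "a \<in> ?C" "b \<in> ?C" by (auto simp: double_coset_def)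
      then have e: "z \<otimes> inv g = a \<otimes> (g \<otimes> b \<otimes> inv g)" using assms(6) by (simp add: m_assoc)
      have "a \<in> N" "g \<otimes> b \<otimes> inv g \<in> N" using ab CN Nn.inv_op_closed2[OF assms(6)] by auto
      then show "z \<otimes> inv g \<in> ?Z \<inter> N"
        unfolding e using card_centralizer_inter_conj(2)[OF assms(1,2,6) m ab(2,3)] by blast
    qed
    moreover have "inj_on (\<lambda>z. z \<otimes> inv g) (double_coset ?C g)"
      using assms(6) by (intro inj_on_g) (auto simp: double_coset_def)
    ultimately have "card (double_coset ?C g) \<le> card (?Z \<inter> N)"
      using fN card_inj_on_le[of _ _ "?Z \<inter> N"] by blast
    then have "?Z \<inter> N = N" using fN assms(5,7) by (intro card_seteq) auto
    then show ?thesis using v by blast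
  qed
  have sq1: "z \<otimes> z = \<one>" if "z \<in> derived G N" for z
  proof -
    let ?U = "{z \<in> ?M. z \<otimes> z = \<one>}"
    have Ms: "subgroup ?M G" by (rule inter_conj_subgroup[OF C.subgroup_axioms assms(6)])
    interpret M: subgroup ?M G by fact
    have MsN: "?M \<subseteq> N" using inter_conj_subset CN by blast
    \<comment> \<open>Since \<open>M\<close> is abelian, the elements squaring to 1 form a subgroup,
      so it is enough to check commutators instead of their products.\<close>
    have U: "subgroup ?U G"
    proof (rule subgroupI)
      show "?U \<subseteq> carrier G" using M.subset by blast
      have "\<one> \<in> ?U" using M.one_closed by simp
      then show "?U \<noteq> {}" by blast
      fix a assume a: "a \<in> ?U"
      then have ac: "a \<in> carrier G" using M.subset by blast
      have "inv a = a" using a ac by (simp add: inv_equality)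
      then show "inv a \<in> ?U" using a by simp
      fix b assume b: "b \<in> ?U"
      then have bc: "b \<in> carrier G" using M.subset by blast
      have ba: "b \<otimes> a = a \<otimes> b" using MN[of a b] a b MsN by blast
      have "(a \<otimes> b) \<otimes> (a \<otimes> b) = a \<otimes> (b \<otimes> a) \<otimes> b" using ac bc by (simp add: m_assoc)
      also have "\<dots> = (a \<otimes> a) \<otimes> (b \<otimes> b)" unfolding ba using ac bc by (simp add: m_assoc)
      finally show "a \<otimes> b \<in> ?U" using a b by simp
    qed
    have "derived_set G N \<subseteq> ?U"
    proof (intro UN_least subsetI)
      fix v w c assume v: "v \<in> N" and w: "w \<in> N" and c: "c \<in> {v \<otimes> w \<otimes> inv v \<otimes> inv w}"
      have vw: "v \<in> carrier G" "w \<in> carrier G" using v w by auto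
      have c: "c = v \<otimes> w \<otimes> inv v \<otimes> inv w" using c by simp
      then have cc: "c \<in> carrier G" using vw by simp
      have "c \<in> derived G N" unfolding derived_def c using v w by (intro generate.incl) blast
      then have cM: "c \<in> ?M" by (rule DM)
      have 1: "w \<otimes> (v \<otimes> v) = (v \<otimes> v) \<otimes> w" by (rule MN[OF sqM[OF v] w])
      have 2: "v \<otimes> c = c \<otimes> v" by (rule MN[OF cM v])
      \<comment> \<open>From \<open>v w = c w v\<close> and \<open>v c = c v\<close> follows
        \<open>v v w = c c w v v\<close>. As \<open>v v\<close> commutes with \<open>w\<close>,
        cancellation gives \<open>c c = 1\<close>.\<close>
      have "v \<otimes> w = c \<otimes> w \<otimes> v" using vw unfolding c by (simp add: m_assoc)
      then have "v \<otimes> (v \<otimes> w) = v \<otimes> (c \<otimes> w \<otimes> v)" by simp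
      also have "\<dots> = (v \<otimes> c) \<otimes> w \<otimes> v" using vw cc by (simp add: m_assoc)
      also have "\<dots> = c \<otimes> (v \<otimes> w) \<otimes> v" unfolding 2 using vw cc by (simp add: m_assoc)
      also have "\<dots> = c \<otimes> (c \<otimes> w \<otimes> v) \<otimes> v" using \<open>v \<otimes> w = c \<otimes> w \<otimes> v\<close> by simp
      also have "\<dots> = (c \<otimes> c) \<otimes> (w \<otimes> (v \<otimes> v))" using vw cc by (simp add: m_assoc)
      also have "\<dots> = (c \<otimes> c) \<otimes> (v \<otimes> (v \<otimes> w))" unfolding 1 using vw by (simp add: m_assoc)
      finally have "c \<otimes> c = \<one>" using vw cc by simp
      then show "c \<in> ?U" using cM by simp
    qed
    then have "derived G N \<subseteq> ?U" unfolding derived_def by (rule generate_subgroup_incl[OF _ U])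
    then show ?thesis using that by blast
  qed
  show ?thesis
  proof
    fix z assume "z \<in> derived G (derived G (carrier G))"
    then have z: "z \<in> derived G N" using mono_derived[OF GN] by blast
    have zc: "z \<in> carrier G" using z by auto
    have "z \<otimes> u = u \<otimes> z" if u: "u \<in> carrier G" for u
    proof (cases "z = \<one>")
      case False
      \<comment> \<open>Both \<open>z\<close> and its conjugate lie in the derived subgroup of
        \<open>N\<close>, hence in \<open>C\<close>, and square to 1; so both are the one involution
        of \<open>C\<close>.\<close>
      have uz: "u \<otimes> z \<otimes> inv u \<in> derived G N" by (rule D.inv_op_closed2[OF u z])
      have "u \<otimes> z \<otimes> inv u \<noteq> \<one>"
      proof
        assume "u \<otimes> z \<otimes> inv u = \<one>"
        then have "z = inv u \<otimes> \<one> \<otimes> u" using conj_cancel(1)[OF u zc] by simp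
        then show False using False u by simp
      qed
      then have "u \<otimes> z \<otimes> inv u = x [^] (ord x div 2)"
        using uz DC sq1[OF uz] by (intro cyclic_involution_unique[OF assms(1,2)]) auto
      moreover have "z = x [^] (ord x div 2)"
        using z DC sq1[OF z] False by (intro cyclic_involution_unique[OF assms(1,2)]) auto
      ultimately have "u \<otimes> z \<otimes> inv u = z" by simp
      then have "u \<otimes> z \<otimes> inv u \<otimes> u = z \<otimes> u" by simp
      then show ?thesis using u zc by (simp add: m_assoc)
    qed (use u in simp)
    then show "z \<in> group_center G" using zc by (simp add: group_center_def)
  qed
qed

text \<open>Requiring both directions of conjugation makes closure of \<open>N\<close> under
  inverses immediate by symmetry.\<close>

lemma (in group) normalizer_cyclic_subgroup:
  assumes "finite (carrier G)" "x \<in> carrier G"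
  defines "N \<equiv> {w \<in> carrier G. w \<otimes> x \<otimes> inv w \<in> generate G {x} \<and> inv w \<otimes> x \<otimes> w \<in> generate G {x}}"
  shows "subgroup N G" "generate G {x} \<subseteq> N"
    "\<And>w c. w \<in> N \<Longrightarrow> c \<in> generate G {x} \<Longrightarrow> w \<otimes> c \<otimes> inv w \<in> generate G {x}"
proof -
  let ?C = "generate G {x}"
  interpret C: subgroup ?C G by (rule generate_singleton_subgroup[OF assms(2)])
  have xC: "x \<in> ?C" by (rule generate.incl) simp
  have cl: "w \<otimes> c \<otimes> inv w \<in> ?C" 
    if w: "w \<in> carrier G" "w \<otimes> x \<otimes> inv w \<in> ?C" "c \<in> ?C" for w c
  proof -
    obtain k :: nat where k: "c = x [^] k" using w(3) unfolding mem_generate_singleton[OF assms(1,2)] by blast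
    obtain j :: nat where j: "w \<otimes> x \<otimes> inv w = x [^] j" using w(2) unfolding mem_generate_singleton[OF assms(1,2)] by blast
    have "w \<otimes> c \<otimes> inv w = (x [^] j) [^] k" unfolding k j[symmetric] using conj_pow[OF w(1) assms(2)] by simp
    then have "w \<otimes> c \<otimes> inv w = x [^] (j * k)" using assms(2) by (simp add: nat_pow_pow)
    then show ?thesis unfolding mem_generate_singleton[OF assms(1,2)] by blast
  qed
  show "w \<otimes> c \<otimes> inv w \<in> ?C" if "w \<in> N" "c \<in> ?C" for w c
    using cl[of w c] that unfolding N_def by blast
  show "?C \<subseteq> N" using xC C.subset by (auto simp: N_def)
  show "subgroup N G"
  proof (rule subgroupI)
    show "N \<noteq> {}" using xC assms(2) by (auto simp: N_def intro!: exI[of _ \<one>])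
    fix a assume a: "a \<in> N"
    then show "inv a \<in> N" by (simp add: N_def)
    fix b assume b: "b \<in> N"
    have ab: "a \<in> carrier G" "b \<in> carrier G" using a b by (auto simp: N_def)
    have "a \<otimes> b \<otimes> x \<otimes> inv (a \<otimes> b) = a \<otimes> (b \<otimes> x \<otimes> inv b) \<otimes> inv a"
      "inv (a \<otimes> b) \<otimes> x \<otimes> (a \<otimes> b) = inv b \<otimes> (inv a \<otimes> x \<otimes> a) \<otimes> b"
      using ab assms(2) by (simp_all add: m_assoc inv_mult_group)
    moreover have "a \<otimes> (b \<otimes> x \<otimes> inv b) \<otimes> inv a \<in> ?C" using cl[of a] a b by (simp add: N_def)
    moreover have "inv b \<otimes> (inv a \<otimes> x \<otimes> a) \<otimes> b \<in> ?C" using cl[of "inv b"] a b by (simp add: N_def)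
    ultimately show "a \<otimes> b \<in> N" using ab by (simp add: N_def)
  qed (auto simp: N_def)
qed

text \<open>Conjugation is an injective self-map of the finite set \<open>C\<close>, hence onto, and
  surjectivity gives the other direction of conjugation.\<close>

lemma (in group) normalizes_of_inter_conj_eq:
  assumes "finite (carrier G)" "x \<in> carrier G" "g \<in> carrier G" "inter_conj (generate G {x}) g = generate G {x}"
  shows "g \<otimes> x \<otimes> inv g \<in> generate G {x}" "inv g \<otimes> x \<otimes> g \<in> generate G {x}"
proof -
  let ?C = "generate G {x}" let ?f = "\<lambda>c. inv g \<otimes> c \<otimes> g"
  interpret C: subgroup ?C G by (rule generate_singleton_subgroup[OF assms(2)])
  have xC: "x \<in> ?C" by (rule generate.incl) simp
  have fC: "finite ?C" using assms(1) finite_subset[OF C.subset] by auto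
  have into: "?f ` ?C \<subseteq> ?C"
  proof (rule image_subsetI)
    fix c assume "c \<in> ?C"
    then have "c \<in> inter_conj ?C g" using assms(4) by simp
    then show "inv g \<otimes> c \<otimes> g \<in> ?C" by (simp add: inter_conj_def)
  qed
  then show "inv g \<otimes> x \<otimes> g \<in> ?C" using xC by blast
  have "inj_on ?f ?C"
  proof (rule inj_onI)
    fix a b assume "a \<in> ?C" "b \<in> ?C" and e: "inv g \<otimes> a \<otimes> g = inv g \<otimes> b \<otimes> g"
    then have "a \<in> carrier G" "b \<in> carrier G" by auto
    then show "a = b" using e assms(3) by simp
  qed
  then have "?f ` ?C = ?C" by (rule endo_inj_surj[OF fC into])
  then have "x \<in> ?f ` ?C" using xC by (simp only:)
  then obtain c where c: "x = inv g \<otimes> c \<otimes> g" "c \<in> ?C" by (rule imageE)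
  have cc: "c \<in> carrier G" using c(2) by auto
  have "g \<otimes> x \<otimes> inv g = c" unfolding c(1) by (rule conj_cancel(2)[OF assms(3) cc])
  then show "g \<otimes> x \<otimes> inv g \<in> ?C" using c by simp
qed

lemma (in group) double_coset_disjoint:
  assumes "subgroup C G" "g \<in> carrier G" "u \<in> carrier G" "u \<notin> double_coset C g"
  shows "double_coset C u \<inter> double_coset C g = {}"
proof (rule ccontr)
  interpret C: subgroup C G by fact
  assume "double_coset C u \<inter> double_coset C g \<noteq> {}"
  then obtain a b a' b' where e: "a \<otimes> u \<otimes> b = a' \<otimes> g \<otimes> b'" and m: "a \<in> C" "b \<in> C" "a' \<in> C" "b' \<in> C"
    by (auto simp: double_coset_def)
  have c: "a \<in> carrier G" "b \<in> carrier G" "a' \<in> carrier G" "b' \<in> carrier G" using m by auto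
  have "u = inv a \<otimes> (a \<otimes> u \<otimes> b) \<otimes> inv b" using c assms by (simp add: m_assoc) (simp add: m_assoc[symmetric])
  also have "\<dots> = (inv a \<otimes> a') \<otimes> g \<otimes> (b' \<otimes> inv b)" unfolding e using c assms by (simp add: m_assoc)
  finally have "u \<in> double_coset C g" unfolding double_coset_def using m
    by (intro image_eqI[of _ _ "(inv a \<otimes> a', b' \<otimes> inv b)"]) auto
  then show False using assms by simp
qed

text \<open>The index \<open>t\<close> of the intersection in \<open>C\<close> is 1, 2 or 3. If 3
  occurs, the action on cosets is two-transitive and a central quotient has order 12. Otherwise
  \<open>t = 2\<close> outside the normalizer \<open>N\<close> of \<open>C\<close>, and the cases
  are distinguished by the index \<open>k\<close> of \<open>C\<close> in \<open>N\<close>.\<close>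

lemma (in group) derived2_central_index_4:
  assumes "finite (carrier G)" "x \<in> carrier G" "order G = 4 * ord x"
  shows "derived G (derived G (carrier G)) \<subseteq> group_center G"
proof -
  let ?C = "generate G {x}"
  interpret C: subgroup ?C G by (rule generate_singleton_subgroup[OF assms(2)])
  have fC: "finite ?C" using assms(1) finite_subset[OF C.subset] by auto
  have o: "ord x > 0" "card ?C = ord x" using ord_ge_1[OF assms(1,2)] generate_pow_card[OF assms(2)] by auto
  have xC: "x \<in> ?C" by (rule generate.incl) simp
  have idx: "\<exists>t. ord x = t * card (inter_conj ?C g) \<and> 0 < t \<and> t \<le> 3 \<and> card (double_coset ?C g) = t * ord x
      \<and> (t = 3 \<longrightarrow> carrier G - ?C \<subseteq> double_coset ?C g)" if g: "g \<in> carrier G" "g \<notin> ?C" for g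
  proof -
    obtain t where t: "card ?C = t * card (inter_conj ?C g)" "t > 0" "t * card ?C + card ?C \<le> order G"
      "card (double_coset ?C g) = t * card ?C" "t * card ?C + card ?C = order G \<Longrightarrow> carrier G - ?C \<subseteq> double_coset ?C g"
      using index_inter_conj[OF assms(1) C.subgroup_axioms g] by metis
    have "(t + 1) * ord x \<le> 4 * ord x" using t(3) unfolding o(2) assms(3) by simp
    then have "t \<le> 3" using o(1) unfolding mult_le_cancel2 by simp
    moreover have "t = 3 \<Longrightarrow> carrier G - ?C \<subseteq> double_coset ?C g" using t(5) unfolding o(2) assms(3) by simp
    ultimately show ?thesis using t(1,2,4) unfolding o(2) by blast
  qed
  show ?thesis
  proof (cases "\<exists>g\<in>carrier G - ?C. ord x = 3 * card (inter_conj ?C g)")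
    case True
    then obtain g where g: "g \<in> carrier G" "g \<notin> ?C" "ord x = 3 * card (inter_conj ?C g)" by blast
    then have 3: "card (double_coset ?C g) = 3 * ord x" "carrier G - ?C \<subseteq> double_coset ?C g"
      using idx[OF g(1,2)] o(1) by (metis mult_cancel2 mult_0_right less_numeral_extra(3))+
    have cen: "inter_conj ?C g \<subseteq> group_center G"
    proof (rule inter_conj_central[OF assms(1,2) g(1) assms(3) 3(1)])
      fix k :: nat assume k: "k dvd 4" "3 \<le> k"
      then have "k \<le> 4" by (intro dvd_imp_le) auto
      then have "k = 3 \<or> k = 4" using k by linarith
      then show "k = 4" using k by auto
    qed
    have o4: "order G = Suc 3 * ord x" using assms(3) by simp
    obtain H :: "nat monoid" and h D where H: "group_hom G H h" "h ` carrier G = carrier H"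
      "kernel G H h = inter_conj ?C g" "finite (carrier H)" "order H = Suc 3 * 3"
      "subgroup D H" "card D = 3" "\<And>w. w \<in> carrier H \<Longrightarrow> w \<notin> D \<Longrightarrow> group.inter_conj H D w \<subseteq> {\<one>\<^bsub>H\<^esub>}"
      using quotient_of_two_transitive[OF assms(1,2) g(1) o4 g(3) 3(2)] by blast
    interpret h: group_hom G H h by fact
    have "derived H (derived H (carrier H)) \<subseteq> {\<one>\<^bsub>H\<^esub>}"
      using h.H.derived2_trivial_of_two_transitive_4[OF H(4) _ H(6,7,8)] H(5) by simp
    from h.derived2_subset_kernel[OF H(2) this] show ?thesis using H(3) cen by auto
  next
    case no3: False
  define N where "N = {w \<in> carrier G. w \<otimes> x \<otimes> inv w \<in> ?C \<and> inv w \<otimes> x \<otimes> w \<in> ?C}"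
  note NN = normalizer_cyclic_subgroup[OF assms(1,2), folded N_def]
  interpret N: subgroup N G by (rule NN(1))
  obtain k where k: "card N = k * ord x" using card_subgroup_dvd[OF C.subgroup_axioms NN(1,2)] o(2) by (metis dvdE mult.commute)
  have "k dvd 4" using card_subgroup_dvd_order[OF NN(1)] k o(1) assms(3) by simp
  then have "k \<le> 4" "k \<noteq> 0" "k \<noteq> 3" using dvd_imp_le[of k 4] by (auto intro!: Nat.gr0I)
  have t2: "card (double_coset ?C g) = 2 * ord x" if g: "g \<in> carrier G" "g \<notin> N" for g
  proof -
    have gC: "g \<notin> ?C" using g NN(2) by blast
    obtain t where t: "ord x = t * card (inter_conj ?C g)" "0 < t" "t \<le> 3" "card (double_coset ?C g) = t * ord x"
      using idx[OF g(1) gC] by blast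
    have "t \<noteq> 3" using t(1) no3 g(1) gC by blast
    moreover have "t \<noteq> 1"
    proof
      assume "t = 1"
      then have "card (inter_conj ?C g) = card ?C" using t(1) o(2) by simp
      then have "inter_conj ?C g = ?C" using fC by (intro card_subset_eq inter_conj_subset) auto
      from normalizes_of_inter_conj_eq[OF assms(1,2) g(1) this] have "g \<in> N" unfolding N_def using g(1) by blast
      then show False using g(2) by contradiction
    qed
    ultimately have "t = 2" using t(2,3) by linarith
    then show ?thesis using t(4) by simp
  qed
  from \<open>k \<le> 4\<close> \<open>k \<noteq> 0\<close> \<open>k \<noteq> 3\<close> consider "k = 1" | "k = 2" | "k = 4" by linarith
  then show ?thesis
  proof cases
    case 3
    then have "N = carrier G" using k assms(1,3) by (intro card_subset_eq N.subset) (auto simp: order_def)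
    then have "g \<otimes> x \<otimes> inv g \<in> ?C" if "g \<in> carrier G" for g using that unfolding N_def by blast
    then have "?C \<lhd> G" by (rule generate_singleton_normal[OF assms(1,2)])
    moreover have "card (rcosets ?C) * ord x = 4 * ord x" using lagrange[OF C.subgroup_axioms] o assms by simp
    ultimately have "derived G (carrier G) \<subseteq> ?C" using assms(1) o by (intro derived_subset_small_index) auto
    then have "derived G (derived G (carrier G)) \<subseteq> {\<one>}"
      by (rule derived2_trivial) (use C.subset generate_singleton_comm[OF assms(1,2)] in auto)
    then show ?thesis using one_in_center by blast
  next
    case other: 2
    then have "N \<noteq> carrier G" using k o assms(3) by (auto simp: order_def)
    then obtain g where g: "g \<in> carrier G" "g \<notin> N" using N.subset by blast
    have "card (double_coset ?C g) = 2 * ord x" using t2[OF g] by blast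
    then show ?thesis
      using assms(3) k other by (intro derived2_central_normalizer_index_2[OF assms(1,2) NN(1) _ _ g(1) _ NN(2,3)]) auto
  next
    \<comment> \<open>Here every double coset outside \<open>C\<close> has \<open>2 * ord x\<close>
      elements, while the complement of \<open>C\<close> has \<open>3 * ord x\<close>. Two disjoint
      such double cosets would fill \<open>G\<close>, although neither contains 1.\<close>
    case 1
    then have NC: "N = ?C" using k o fC NN(2) N.subset assms(1) by (intro card_seteq[symmetric]) (auto intro: finite_subset)
    have "?C \<noteq> carrier G" using o assms(3) by (auto simp: order_def)
    then obtain g where g: "g \<in> carrier G" "g \<notin> N" using NC C.subset by blast
    have gd: "card (double_coset ?C g) = 2 * ord x" using t2[OF g] by blast
    have dsub: "double_coset ?C v \<subseteq> carrier G" if "v \<in> carrier G" for v using that by (auto simp: double_coset_def)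
    have fd: "finite (double_coset ?C v)" if "v \<in> carrier G" for v using dsub[OF that] assms(1) finite_subset by blast
    have "card (?C \<union> double_coset ?C g) \<le> 3 * ord x" using card_Un_le[of ?C "double_coset ?C g"] gd o by simp
    then have "?C \<union> double_coset ?C g \<noteq> carrier G" using o assms(3) by (auto simp: order_def)
    then obtain u where u: "u \<in> carrier G" "u \<notin> ?C" "u \<notin> double_coset ?C g" using C.subset dsub[OF g(1)] by blast
    have ud: "card (double_coset ?C u) = 2 * ord x" using t2[of u] u NC by blast
    have "double_coset ?C u \<inter> double_coset ?C g = {}" by (rule double_coset_disjoint[OF C.subgroup_axioms g(1) u(1,3)])
    then have "card (double_coset ?C u \<union> double_coset ?C g) = 4 * ord x"
      using card_Un_disjoint[OF fd[OF u(1)] fd[OF g(1)]] ud gd by simp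
    then have all: "double_coset ?C u \<union> double_coset ?C g = carrier G"
      using dsub u(1) g(1) assms by (intro card_subset_eq) (auto simp: order_def)
    have oneC: "\<one> \<notin> double_coset ?C v" if v: "v \<in> carrier G" "v \<notin> ?C" for v
    proof
      assume "\<one> \<in> double_coset ?C v"
      then obtain a b where ab: "a \<otimes> v \<otimes> b = \<one>" "a \<in> ?C" "b \<in> ?C" by (auto simp: double_coset_def)
      have c: "a \<in> carrier G" "b \<in> carrier G" using ab by auto
      have "v = inv a \<otimes> (a \<otimes> v \<otimes> b) \<otimes> inv b" using c v by (simp add: m_assoc) (simp add: m_assoc[symmetric])
      also have "\<dots> = inv a \<otimes> inv b" unfolding ab(1) using c by simp
      finally show False using ab v by auto
    qed
    have "\<one> \<in> double_coset ?C u \<union> double_coset ?C g" unfolding all by simp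
    then show ?thesis using oneC[OF u(1,2)] oneC[OF g(1)] g(2) NC by blast
  qed
  qed
qed

section \<open>Removal of the large primes\<close>

text \<open>In a cyclic group of order \<open>q r\<close>, the solutions of \<open>w^q = 1\<close>
  form the subgroup generated by the \<open>r\<close>-th power of the generator. This brings a
  conjugate of that power, once known to lie in \<open>C\<close>, back into the subgroup.\<close>

lemma (in group) mem_generate_root:
  assumes "finite (carrier G)" "x \<in> carrier G" "ord x = q * r" "w \<in> generate G {x}" "w [^] q = \<one>"
  shows "w \<in> generate G {x [^] r}"
proof -
  obtain k :: nat where k: "w = x [^] k" using assms(4) unfolding mem_generate_singleton[OF assms(1,2)] by blast
  have "x [^] (k * q) = \<one>" using assms(5) unfolding k by (simp add: nat_pow_pow assms(2))
  then have "r * q dvd k * q" using assms(2,3) by (simp add: pow_eq_id mult.commute)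
  moreover have "q > 0" using ord_ge_1[OF assms(1,2)] assms(3) by (cases q) auto
  ultimately have "r dvd k" by simp
  then obtain j where "k = r * j" by (metis dvdE)
  then have "w = (x [^] r) [^] j" unfolding k by (simp add: nat_pow_pow assms(2))
  then show ?thesis using mem_generate_singleton[OF assms(1)] assms(2) by blast
qed

text \<open>In \<open>np\<close>, \<open>t\<close> is the index of \<open>C \<inter> gCg\<^sup>-\<^sup>1\<close> in \<open>C = \<langle>x\<rangle>\<close>; if \<open>p\<close> never divides it, the
  Sylow \<open>p\<close>-subgroup of \<open>C\<close> is contained in all conjugates of \<open>C\<close>.\<close>
lemma (in group) normal_sylow_in_cyclic:
  assumes "finite (carrier G)" "x \<in> carrier G" "order G = i * ord x" "Factorial_Ring.prime p" "\<not> p dvd i"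
    and "order G = p ^ a * m"
    and np: "\<And>g t. g \<in> carrier G \<Longrightarrow> g \<notin> generate G {x} \<Longrightarrow> ord x = t * card (inter_conj (generate G {x}) g) \<Longrightarrow> \<not> p dvd t"
  obtains y where "y \<in> carrier G" "ord y = p ^ a" "generate G {y} \<lhd> G"
proof -
  let ?C = "generate G {x}"
  interpret C: subgroup ?C G by (rule generate_singleton_subgroup[OF assms(2)])
  have o: "ord x > 0" "card ?C = ord x" using ord_ge_1[OF assms(1,2)] generate_pow_card[OF assms(2)] by auto
  have cop: "coprime (p ^ a) t" if "\<not> p dvd t" for t using prime_imp_coprime[OF assms(4) that] by simp
  \<comment> \<open>As \<open>p\<close> does not divide the index \<open>i\<close>, the whole power
    \<open>p ^ a\<close> already divides \<open>ord x\<close>.\<close>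
  have "p ^ a dvd i * ord x" unfolding assms(3)[symmetric] unfolding assms(6) by simp
  then have "p ^ a dvd ord x" using cop[OF assms(5)] by (simp add: coprime_dvd_mult_right_iff)
  then obtain r where r: "ord x = p ^ a * r" by (metis dvdE)
  have r0: "r > 0" using o r by (cases r) auto
  define y where "y = x [^] r"
  have yc: "y \<in> carrier G" using assms(2) by (simp add: y_def)
  have yC: "y \<in> ?C" unfolding mem_generate_singleton[OF assms(1,2)] y_def by blast
  have oy: "ord y = p ^ a" unfolding y_def using ord_pow_gen[OF assms(2), of r] r r0 by simp
  have conjC: "inv g \<otimes> y \<otimes> g \<in> ?C" if g: "g \<in> carrier G" for g
  proof (cases "g \<in> ?C")
    case False
    let ?M = "inter_conj ?C g"
    have Ms: "subgroup ?M G" by (rule inter_conj_subgroup[OF C.subgroup_axioms g])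
    obtain t where t: "card ?C = t * card ?M" using index_inter_conj[OF assms(1) C.subgroup_axioms g False] by metis
    have "ord x = t * card ?M" using t o(2) by (simp only:)
    then have "coprime (p ^ a) t" by (intro cop np[OF g False])
    \<comment> \<open>The \<open>t\<close>-th power of \<open>y\<close> lies in the intersection of
      index \<open>t\<close>; since \<open>t\<close> is invertible modulo \<open>ord y\<close>, so
      does \<open>y\<close> itself.\<close>
    then have "coprime t (p ^ a)" by (rule coprime_commute[THEN iffD1])
    then obtain u where u: "[t * u = Suc 0] (mod p ^ a)" using cong_solve_coprime_nat by blast
    have "y [^] t \<in> ?M" by (rule pow_index_mem_comm[OF assms(1,2) Ms inter_conj_subset t yC])
    then have "(y [^] t) [^] int u \<in> ?M" by (rule subgroup_int_pow_closed[OF Ms])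
    then have M: "y [^] int (t * u) \<in> ?M" using yc by (simp add: int_pow_int nat_pow_pow del: of_nat_mult)
    have "[int (t * u) = int 1] (mod int (p ^ a))" using u unfolding cong_int_iff by simp
    then have "int (ord y) dvd 1 - int (t * u)" unfolding oy by (simp add: cong_iff_dvd_diff dvd_diff_commute)
    then have "y [^] int (t * u) = y [^] (1::int)" by (simp only: int_pow_eq[OF yc])
    then have "y [^] int (t * u) = y" using yc by (simp add: int_pow_1)
    then have "y \<in> ?M" using M by (simp only:)
    then show ?thesis by (simp add: inter_conj_def)
  qed (use yC in auto)
  have "generate G {y} \<lhd> G"
  proof (rule generate_singleton_normal[OF assms(1) yc])
    fix g assume g: "g \<in> carrier G"
    \<comment> \<open>The conjugate lies in \<open>C\<close> and is killed by \<open>p ^ a\<close>,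
      and all such elements of \<open>C\<close> are powers of \<open>y\<close>.\<close>
    have "g \<otimes> y \<otimes> inv g \<in> ?C" using conjC[of "inv g"] g by simp
    moreover have "(g \<otimes> y \<otimes> inv g) [^] p ^ a = \<one>"
      using conj_pow[OF g yc, of "p ^ a"] pow_ord_eq_1[OF yc] g unfolding oy by simp
    ultimately show "g \<otimes> y \<otimes> inv g \<in> generate G {y}"
      unfolding y_def[symmetric] using mem_generate_root[OF assms(1,2) r] unfolding y_def by blast
  qed
  then show thesis using that yc oy by blast
qed

section \<open>Induction on the group order\<close>

lemma (in group) exists_large_order:
  assumes "finite (carrier G)"
  obtains x where "x \<in> carrier G" "psi G \<le> order G * ord x"
proof -
  have ne: "ord ` carrier G \<noteq> {}" "finite (ord ` carrier G)" using assms one_closed by auto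
  then obtain x where x: "x \<in> carrier G" "ord x = Max (ord ` carrier G)" using Max_in by (metis imageE)
  have "psi G \<le> (\<Sum>g\<in>carrier G. ord x)" unfolding psi_def x(2) using ne by (intro sum_mono Max_ge) auto
  then show thesis using that x(1) by (simp add: order_def)
qed

text \<open>The passage to \<open>G/P\<close>: the prime \<open>p\<close> moves from the order of
  the group into \<open>S\<close>, and the loss in the inequality becomes the new factor of
  \<open>excess\<close>.\<close>

lemma (in group) derived2_central_peel:
  fixes S :: "nat set"
  assumes "finite (carrier G)" "finite S" "\<forall>q\<in>S. Factorial_Ring.prime q \<and> 5 \<le> q"
    and "S \<inter> prime_factors (order G) = {}"
    and hyp: "3/5 * real (order G) * real (totient (order G)) \<le> real (psi G) * excess S"
    and p: "Factorial_Ring.prime p" "5 \<le> p" "p dvd order G"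
    and decomp: "order G = p ^ a * m" "\<not> p dvd m"
    and y: "y \<in> carrier G" "ord y = p ^ a" "generate G {y} \<lhd> G"
    and IH: "\<And>(H::nat monoid) T. \<lbrakk>order H < order G; group H; finite (carrier H); finite T;
      \<forall>q\<in>T. Factorial_Ring.prime q \<and> 5 \<le> q; T \<inter> prime_factors (order H) = {};
      3/5 * real (order H) * real (totient (order H)) \<le> real (psi H) * excess T\<rbrakk>
      \<Longrightarrow> derived H (derived H (carrier H)) \<subseteq> group_center H"
  shows "derived G (derived G (carrier G)) \<subseteq> group_center G"
proof -
  have o0: "order G > 0" using assms(1) order_gt_0_iff_finite by simp
  have a: "a > 0" using p(3) decomp by (cases a) auto
  obtain H :: "nat monoid" and h where H: "group H" "group_hom G H h" "h ` carrier G = carrier H" "kernel G H h = generate G {y}"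
    "order G = order H * card (generate G {y})" "finite (carrier H)" using quotient_on_nat[OF assms(1) y(3)] by blast
  interpret h: group_hom G H h by fact
  have cy: "card (generate G {y}) = p ^ a" using generate_pow_card[OF y(1)] y(2) by simp
  have pa: "p ^ a > 1" using prime_gt_1_nat[OF p(1)] a by (rule one_less_power)
  have "order H * p ^ a = m * p ^ a" using H(5) decomp(1) unfolding cy by (simp only: mult.commute)
  moreover have "p ^ a \<noteq> 0" using pa by linarith
  ultimately have oH: "order H = m" by (metis mult_right_cancel)
  have m0: "m > 0" using o0 decomp(1) by (cases m) auto
  have cop: "coprime (p ^ a) m" using prime_imp_coprime[OF p(1) decomp(2)] by simp
  have tot: "totient (order G) = totient (p ^ a) * totient m" unfolding decomp(1) by (rule totient_mult_coprime[OF cop])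
  have pS: "p \<notin> S" using assms(4) p(1,3) o0 by (auto simp: prime_factors_dvd)
  define c where "c = real (p ^ a) * real (totient (p ^ a))"
  have "0 < p ^ a" using pa by linarith
  then have c0: "c > 0" unfolding c_def by (intro mult_pos_pos) (simp_all only: of_nat_0_less_iff totient_gt_0_iff)
  have e0: "excess S \<ge> 0" using assms(3) by (intro prod_nonneg) (auto intro!: add_nonneg_nonneg)
  define f where "f = 1 + 1 / (real p * (real p - 1))"
  have eS: "excess (insert p S) = f * excess S" unfolding f_def using assms(2) pS by simp
  have psiG: "real (psi G) \<le> c * f * real (psi H)"
  proof -
    have "psi G \<le> (\<Sum>z\<in>generate G {y}. ord z) * psi H"
      using cop by (intro h.psi_le[OF assms(1) H(3) y(1) H(4)]) (simp add: y(2) oH)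
    then have "real (psi G) \<le> real (\<Sum>z\<in>generate G {y}. ord z) * real (psi H)"
      by (simp only: of_nat_mult[symmetric] of_nat_le_iff)
    also have "\<dots> \<le> c * f * real (psi H)"
      unfolding c_def f_def by (intro mult_right_mono sum_ord_cyclic_le[OF assms(1) y(1,2) a p(1)]) simp
    finally show ?thesis .
  qed
  have "derived H (derived H (carrier H)) \<subseteq> group_center H"
  proof (rule IH[OF _ H(1,6), of "insert p S"])
    show "order H < order G" unfolding oH decomp(1) using m0 pa by simp
    show "insert p S \<inter> prime_factors (order H) = {}"
    proof -
      have "prime_factors m \<subseteq> prime_factors (order G)" using o0 unfolding decomp(1) by (intro dvd_prime_factors) auto
      moreover have "p \<notin> prime_factors m" using decomp(2) by (auto simp: prime_factors_dvd)
      ultimately show ?thesis using assms(4) unfolding oH by blast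
    qed
    \<comment> \<open>By multiplicativity of the totient, \<open>c\<close> splits off the left-hand
      side exactly. The estimate for \<open>psi\<close> yields the same \<open>c\<close> times
      \<open>f\<close> on the right, so \<open>c\<close> cancels.\<close>
    have "c * (3/5 * real m * real (totient m)) = 3/5 * real (order G) * real (totient (order G))"
      unfolding c_def tot by (subst decomp(1)) (simp only: of_nat_mult mult_ac)
    also have "\<dots> \<le> real (psi G) * excess S" by (rule hyp)
    also have "\<dots> \<le> c * f * real (psi H) * excess S" by (rule mult_right_mono[OF psiG e0])
    also have "\<dots> = c * (real (psi H) * excess (insert p S))" unfolding eS by (simp only: mult_ac)
    finally show "3/5 * real (order H) * real (totient (order H)) \<le> real (psi H) * excess (insert p S)"
      unfolding oH using c0 by (simp only: mult_le_cancel_left_pos)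
  qed (use assms(2,3) p in auto)
  then show ?thesis
    using cop H(5) by (intro h.derived2_central_lift[OF assms(1) H(3) y(1) H(4)]) (simp_all add: y(2) oH cy)
qed

text \<open>\<open>S\<close> collects the primes already divided out. The type \<open>nat\<close> makes induction through quotients possible.\<close>
lemma derived2_central_nat:
  fixes G :: "nat monoid" and S :: "nat set"
  assumes "group G" "finite (carrier G)" "finite S" "\<forall>q\<in>S. Factorial_Ring.prime q \<and> 5 \<le> q"
    and "S \<inter> prime_factors (order G) = {}"
    and "3/5 * real (order G) * real (totient (order G)) \<le> real (psi G) * excess S"
  shows "derived G (derived G (carrier G)) \<subseteq> group_center G"
  using assms
proof (induction "order G" arbitrary: G S rule: less_induct)
  case (less G S)
  interpret group G by fact
  note fin = less.prems(2)
  define n where "n = order G"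
  have n0: "n > 0" using fin order_gt_0_iff_finite unfolding n_def by simp
  obtain x where x: "x \<in> carrier G" "psi G \<le> n * ord x" using exists_large_order[OF fin] unfolding n_def by blast
  obtain i where "order G = ord x * i" using ord_dvd_group_order[OF x(1)] by (metis dvdE)
  then have i: "order G = i * ord x" by (simp only: mult.commute)
  have ni: "n = i * ord x" using i unfolding n_def .
  have i0: "i > 0" using n0 ni by (cases i) auto
  have o: "ord x > 0" using ord_ge_1[OF fin x(1)] by simp
  have e0: "excess S \<ge> 0" using less.prems(4) by (intro prod_nonneg) (auto intro!: add_nonneg_nonneg)
  have bound: "real i \<le> 5/3 * (real n / real (totient n) * excess S)"
  proof -
    have t0: "real (totient n) > 0" using n0 by simp
    have "3/5 * real n * real (totient n) \<le> real (psi G) * excess S" using less.prems(6) unfolding n_def .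
    also have "\<dots> \<le> real (n * ord x) * excess S" using x(2) by (intro mult_right_mono e0) (simp only: of_nat_le_iff)
    finally have "real n * (3/5 * real (totient n)) \<le> real n * (real (ord x) * excess S)" by (simp add: mult_ac)
    then have "3/5 * real (totient n) \<le> real (ord x) * excess S" using n0 by simp
    then have "real i * (3/5 * real (totient n)) \<le> real i * (real (ord x) * excess S)" by (intro mult_left_mono) auto
    also have "\<dots> = real n * excess S" unfolding ni by simp
    finally show ?thesis using t0 by (simp add: field_simps)
  qed
  have SS: "S \<inter> prime_factors n = {}" using less.prems(5) unfolding n_def .
  have peel: ?case if p: "Factorial_Ring.prime p" "5 \<le> p" "p \<in> prime_factors n" "\<not> p dvd i"
    and np: "\<And>g t. g \<in> carrier G \<Longrightarrow> g \<notin> generate G {x} \<Longrightarrow> ord x = t * card (inter_conj (generate G {x}) g) \<Longrightarrow> \<not> p dvd t" for p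
  proof -
    have pn: "p dvd order G" using p(3) unfolding n_def by (rule in_prime_factors_imp_dvd)
    obtain m where m: "order G = p ^ multiplicity p (order G) * m" "\<not> p dvd m"
    proof (rule multiplicity_decompose'[of "order G" p])
      show "order G \<noteq> 0" using n0 unfolding n_def by simp
      show "\<not> is_unit p" using prime_gt_1_nat[OF p(1)] by simp
    qed
    obtain y where y: "y \<in> carrier G" "ord y = p ^ multiplicity p (order G)" "generate G {y} \<lhd> G"
      by (rule normal_sylow_in_cyclic[OF fin x(1) i p(1,4) m(1)], erule (2) np)
    show ?thesis
      by (rule derived2_central_peel[OF fin less.prems(3-6) p(1,2) pn m y less.hyps])
  qed
  interpret C: subgroup "generate G {x}" G by (rule generate_singleton_subgroup[OF x(1)])
  have cC: "card (generate G {x}) = ord x" using generate_pow_card[OF x(1)] by simp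
  \<comment> \<open>Any \<open>t\<close> satisfying the index equation is the one supplied by
    \<open>index_inter_conj\<close>, because the intersection is nonempty; so \<open>t\<close> is
    below \<open>i\<close>, with two-transitivity at \<open>t = i - 1\<close>.\<close>
  have tb: "0 < t \<and> t < i \<and> (Suc t = i \<longrightarrow> carrier G - generate G {x} \<subseteq> double_coset (generate G {x}) g)"
    if g: "g \<in> carrier G" "g \<notin> generate G {x}" "ord x = t * card (inter_conj (generate G {x}) g)" for g t
  proof -
    obtain s where s: "ord x = s * card (inter_conj (generate G {x}) g)" "s > 0" "s * ord x + ord x \<le> order G"
      "s * ord x + ord x = order G \<Longrightarrow> carrier G - generate G {x} \<subseteq> double_coset (generate G {x}) g"
      using index_inter_conj[OF fin C.subgroup_axioms g(1,2)] unfolding cC by metis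
    have "card (inter_conj (generate G {x}) g) \<noteq> 0" using o s(1) by (metis mult_0_right less_numeral_extra(3))
    then have "s = t" using s(1) g(3) by (metis mult_right_cancel)
    have "Suc s * ord x \<le> i * ord x" using s(3) unfolding i by simp
    then have "s < i" using o unfolding mult_le_cancel2 by simp
    moreover have "Suc s = i \<Longrightarrow> carrier G - generate G {x} \<subseteq> double_coset (generate G {x}) g"
      by (rule s(4)) (use i in \<open>auto simp: algebra_simps\<close>)
    ultimately show ?thesis using s(2) \<open>s = t\<close> by blast
  qed
  \<comment> \<open>A prime above \<open>i\<close> divides neither \<open>i\<close> nor any of the
    indices \<open>t < i\<close>, so it can always be removed.\<close>
  have peel_small: ?case if p: "Factorial_Ring.prime p" "5 \<le> p" "p \<in> prime_factors n" "i < p" for p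
  proof (rule peel[OF p(1-3)])
    show "\<not> p dvd i" using i0 p(4) by (rule nat_dvd_not_less)
    fix g t assume "g \<in> carrier G" "g \<notin> generate G {x}" "ord x = t * card (inter_conj (generate G {x}) g)"
    then have "0 < t" "t < p" using tb p(4) by (blast, metis less_trans)
    then show "\<not> p dvd t" by (rule nat_dvd_not_less)
  qed
  show ?case
  proof (cases "\<exists>q\<in>prime_factors n. 11 \<le> q")
    case True
    define p where "p = Max (prime_factors n)"
    obtain q where q: "q \<in> prime_factors n" "11 \<le> q" using True by blast
    have pn: "p \<in> prime_factors n" unfolding p_def using q by (intro Max_in) auto
    have pm: "\<forall>q\<in>prime_factors n. q \<le> p" unfolding p_def by (auto intro: Max_ge)
    then have p11: "11 \<le> p" using q by (meson order_trans)
    have "real i < real p"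
      using bound index_bound_large[OF n0 less.prems(3,4) p11 pm] by linarith
    then show ?thesis using pn p11 by (intro peel_small[of p]) (auto dest: in_prime_factors_imp_prime)
  next
    case False
    then have small: "\<forall>q\<in>prime_factors n. q < 11" by (meson not_le)
    note ib = index_bound_small[OF n0 less.prems(3,4) SS small]
    have "real i < 8" using bound ib(1) by linarith
    then have i8: "i < 8" by simp
    show ?thesis
    proof (cases "i = 6")
      case False
      then consider "i = 1" | "i = 4" | "i = 2 \<or> i = 3 \<or> i = 5 \<or> i = 7" using i0 i8 by linarith
      then show ?thesis
      proof cases
        case 1
        then have "generate G {x} = carrier G"
          using i cC fin by (intro card_subset_eq C.subset) (simp_all add: order_def)
        then have "derived G (carrier G) \<subseteq> generate G {x}" using derived_in_carrier[OF subset_refl] by simp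
        then have "derived G (derived G (carrier G)) \<subseteq> {\<one>\<^bsub>G\<^esub>}"
          by (rule derived2_trivial[OF _ C.subset generate_singleton_comm[OF fin x(1)]])
        then show ?thesis using one_in_center by (rule subset_trans)
      next
        case 2
        then show ?thesis using derived2_central_index_4[OF fin x(1)] i by simp
      next
        case 3
        then have "Factorial_Ring.prime i" by auto
        then show ?thesis by (rule derived2_central_prime_index[OF fin x(1) i])
      qed
    next
      \<comment> \<open>The index 6 is settled by removing a prime: 7 if it divides
        \<open>n\<close>, and otherwise 5, which must divide \<open>n\<close> since without 5 and 7
        the bound is \<open>i < 6\<close>.\<close>
      case i6: True
      show ?thesis
      proof (cases "7 \<in> prime_factors n")
        case True
        show ?thesis by (rule peel_small[OF _ _ True]) (use True i6 in \<open>auto dest: in_prime_factors_imp_prime\<close>)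
      next
        case no7: False
        have p5: "5 \<in> prime_factors n"
        proof (rule ccontr)
          assume "5 \<notin> prime_factors n"
          from ib(2)[OF this no7] bound i6 show False by simp
        qed
        then have pr5: "Factorial_Ring.prime (5::nat)" by (rule in_prime_factors_imp_prime)
        show ?thesis
        \<comment> \<open>The obstacle to removing 5 is an index divisible by 5. As
          \<open>t < 6\<close> it equals 5, so the action on the six cosets is two-transitive, which
          is impossible.\<close>
        proof (cases "\<exists>g t. g \<in> carrier G \<and> g \<notin> generate G {x} \<and> ord x = t * card (inter_conj (generate G {x}) g) \<and> 5 dvd t")
          case True
          then obtain g t where g: "g \<in> carrier G" "g \<notin> generate G {x}" "ord x = t * card (inter_conj (generate G {x}) g)" "5 dvd t"
            by blast
          have t: "0 < t" "t < 6" using tb[OF g(1-3)] i6 by auto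
          then have t5: "t = 5" using dvd_imp_le[OF g(4) t(1)] by linarith
          have dc: "carrier G - generate G {x} \<subseteq> double_coset (generate G {x}) g" using tb[OF g(1-3)] i6 t5 by simp
          have o6: "order G = Suc 5 * ord x" using i i6 by simp
          obtain H :: "nat monoid" and h D where H: "group_hom G H h" "finite (carrier H)" "order H = Suc 5 * 5"
            "subgroup D H" "card D = 5" "\<And>w. w \<in> carrier H \<Longrightarrow> w \<notin> D \<Longrightarrow> group.inter_conj H D w \<subseteq> {\<one>\<^bsub>H\<^esub>}"
            using quotient_of_two_transitive[OF fin x(1) g(1) o6 g(3)[unfolded t5] dc] by metis
          interpret h: group_hom G H h by fact
          have False using h.H.no_two_transitive_6[OF H(2) _ H(4,5,6)] H(3) by simp
          then show ?thesis ..
        next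
          case False
          then show ?thesis using i6 by (intro peel[OF pr5 _ p5]) auto
        qed
      qed
    qed
  qed
qed

section \<open>Groups over an arbitrary type, and solvability\<close>

theorem theorem10:
  fixes G (structure)
  assumes "group G"
    and "finite (carrier G)"
    and "real (psi G) \<ge> 3 / 5 * real (order G) * real (totient (order G))"
  shows "solvable G \<and> derived G (derived G (carrier G)) \<subseteq> group_center G"
proof -
  interpret group G by fact
  note fin = assms(2)
  have gen1: "generate G {\<one>} = {\<one>}" by (rule generate_one)
  \<comment> \<open>Dividing by the trivial subgroup yields a copy of \<open>G\<close> on
    \<open>nat\<close>. The lemmas for quotients by a cyclic kernel, applied with
    \<open>y = 1\<close>, carry the hypothesis to the copy and the conclusion back.\<close>
  obtain H :: "nat monoid" and h where H: "group H" "group_hom G H h" "h ` carrier G = carrier H" "kernel G H h = {\<one>}"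
    "order G = order H * card {\<one>}" "finite (carrier H)" using quotient_on_nat[OF fin one_is_normal] by blast
  interpret h: group_hom G H h by fact
  have ker: "kernel G H h = generate G {\<one>}" using H(4) gen1 by simp
  have oH: "order H = order G" using H(5) by simp
  have "psi G \<le> (\<Sum>z\<in>generate G {\<one>}. ord z) * psi H"
    by (rule h.psi_le[OF fin H(3) one_closed ker]) simp
  then have "real (psi G) \<le> real (psi H)" unfolding gen1 by simp
  then have "derived H (derived H (carrier H)) \<subseteq> group_center H"
    using assms(3) by (intro derived2_central_nat[OF H(1,6), of "{}"]) (simp_all add: oH)
  then have D: "derived G (derived G (carrier G)) \<subseteq> group_center G"
    by (intro h.derived2_central_lift[OF fin H(3) one_closed ker]) (simp_all add: oH)
  let ?D = "derived G (derived G (carrier G))"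
  have Ds: "subgroup ?D G" by (intro derived_is_subgroup derived_in_carrier) simp
  \<comment> \<open>A central subgroup is abelian, so the third derived subgroup is trivial.\<close>
  have "derived G ?D \<subseteq> {\<one>}"
    by (rule derived_trivial_of_comm[OF subgroup.subset[OF Ds]])
      (use D subgroup.subset[OF Ds] in \<open>auto simp: group_center_def\<close>)
  moreover have "\<one> \<in> derived G ?D" by (rule subgroup.one_closed[OF derived_is_subgroup[OF subgroup.subset[OF Ds]]])
  ultimately have "(derived G ^^ 3) (carrier G) = {\<one>}" by (auto simp: numeral_3_eq_3)
  then have "solvable G" using solvable_iff_trivial_derived_seq by blast
  then show ?thesis using D by blast
qed

end
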